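(* Let $V$ be a commutative valuation domain with quotient field $F$ such that $J(V)$ is a principal ideal of $V$, let $K/F$ be a finite Galois extension with group $G$, $S$ the integral closure of $V$ in $K$, and $f:G\times G\to S\setminus\{0\}$ a normalized $2$-cocycle. Then $O_l(J_G(A_f))=A_f$ if and only if $f(\sigma,\sigma^{-1})\notin M^2$ for every $\sigma\in G$ and every maximal ideal $M$ of $S$, if and only if $f(\sigma,\tau)\notin M^2$ for every $\sigma,\tau\in G$ and every maximal ideal $M$ of $S$.
   Context: $V$ has arbitrary Krull dimension. A normalized 2-cocycle satisfies $\sigma(f(\tau,\gamma))f(\sigma,\tau\gamma)=f(\sigma,\tau)f(\sigma\tau,\gamma)$, $f(1,\sigma)=f(\sigma,1)=1$; values need not be units. $A_f=\bigoplus_{\sigma\in G}Sx_\sigma$ (free left $S$-module) with $(sx_\sigma)(tx_\tau)=s\,\sigma(t)f(\sigma,\tau)x_{\sigma\tau}$, an order in $\Sigma_f=\bigoplus_\sigma Kx_\sigma=(K/F,G,f)$, $G$-graded with components $Sx_\sigma$. $J_G(A_f)$ is the graded Jacobson radical (intersection of graded left ideals maximal among proper graded left ideals). $O_l(I)=\{x\in\Sigma_f:xI\subseteq I\}$. *)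

theory Defs
  imports Main
begin

definition is_field_aut :: "('k::field \<Rightarrow> 'k) \<Rightarrow> bool" where
  "is_field_aut \<sigma> \<longleftrightarrow> bij \<sigma> \<and> (\<forall>x y. \<sigma> (x + y) = \<sigma> x + \<sigma> y)
     \<and> (\<forall>x y. \<sigma> (x * y) = \<sigma> x * \<sigma> y) \<and> \<sigma> 1 = 1"

text \<open>A finite group G of automorphisms of the field K (the type 'k). By Artin's theorem,
  K / fixed_field G is a finite Galois extension with group G, and every finite Galois
  extension K/F with group G arises this way.\<close>
definition finite_aut_group :: "('k::field \<Rightarrow> 'k) set \<Rightarrow> bool" where
  "finite_aut_group G \<longleftrightarrow> finite G \<and> id \<in> G \<and> (\<forall>\<sigma>\<in>G. is_field_aut \<sigma>)
     \<and> (\<forall>\<sigma>\<in>G. \<forall>\<tau>\<in>G. \<sigma> \<circ> \<tau> \<in> G) \<and> (\<forall>\<sigma>\<in>G. inv \<sigma> \<in> G)"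

definition fixed_field :: "('k::field \<Rightarrow> 'k) set \<Rightarrow> 'k set" where
  "fixed_field G = {x. \<forall>\<sigma>\<in>G. \<sigma> x = x}"

definition subring_of :: "'a::comm_ring_1 set \<Rightarrow> bool" where
  "subring_of R \<longleftrightarrow> 0 \<in> R \<and> 1 \<in> R \<and> (\<forall>x\<in>R. \<forall>y\<in>R. x + y \<in> R \<and> x * y \<in> R)
     \<and> (\<forall>x\<in>R. - x \<in> R)"

definition ideal_in :: "'a::comm_ring_1 set \<Rightarrow> 'a set \<Rightarrow> bool" where
  "ideal_in R I \<longleftrightarrow> I \<subseteq> R \<and> 0 \<in> I \<and> (\<forall>x\<in>I. \<forall>y\<in>I. x + y \<in> I)
     \<and> (\<forall>x\<in>I. - x \<in> I) \<and> (\<forall>r\<in>R. \<forall>x\<in>I. r * x \<in> I)"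

definition maximal_ideal_in :: "'a::comm_ring_1 set \<Rightarrow> 'a set \<Rightarrow> bool" where
  "maximal_ideal_in R M \<longleftrightarrow> ideal_in R M \<and> M \<noteq> R
     \<and> (\<forall>J. ideal_in R J \<and> M \<subseteq> J \<longrightarrow> J = M \<or> J = R)"

definition jacobson_radical :: "'a::comm_ring_1 set \<Rightarrow> 'a set" where
  "jacobson_radical R = {x\<in>R. \<forall>M. maximal_ideal_in R M \<longrightarrow> x \<in> M}"

definition principal_ideal_in :: "'a::comm_ring_1 set \<Rightarrow> 'a set \<Rightarrow> bool" where
  "principal_ideal_in R I \<longleftrightarrow> (\<exists>a\<in>R. I = {r * a | r. r \<in> R})"

definition ideal_sq :: "'a::comm_ring_1 set \<Rightarrow> 'a set" where
  "ideal_sq M = {x. \<exists>(n::nat) a b. (\<forall>i<n. a i \<in> M \<and> b i \<in> M) \<and> x = (\<Sum>i<n. a i * b i)}"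

definition valuation_domain_of :: "'k::field set \<Rightarrow> 'k set \<Rightarrow> bool" where
  "valuation_domain_of V F \<longleftrightarrow> subring_of V \<and> V \<subseteq> F
     \<and> (\<forall>x\<in>F. x \<noteq> 0 \<longrightarrow> x \<in> V \<or> inverse x \<in> V)"

definition integral_closure :: "'k::field set \<Rightarrow> 'k set" where
  "integral_closure V = {x. \<exists>(n::nat) c. (\<forall>i<n. c i \<in> V) \<and> x ^ n + (\<Sum>i<n. c i * x ^ i) = 0}"

definition normalized_cocycle ::
  "('k::field \<Rightarrow> 'k) set \<Rightarrow> 'k set \<Rightarrow> (('k \<Rightarrow> 'k) \<Rightarrow> ('k \<Rightarrow> 'k) \<Rightarrow> 'k) \<Rightarrow> bool" where
  "normalized_cocycle G S f \<longleftrightarrow>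
     (\<forall>\<sigma>\<in>G. \<forall>\<tau>\<in>G. f \<sigma> \<tau> \<in> S - {0})
     \<and> (\<forall>\<sigma>\<in>G. \<forall>\<tau>\<in>G. \<forall>\<gamma>\<in>G. \<sigma> (f \<tau> \<gamma>) * f \<sigma> (\<tau> \<circ> \<gamma>) = f \<sigma> \<tau> * f (\<sigma> \<circ> \<tau>) \<gamma>)
     \<and> (\<forall>\<sigma>\<in>G. f id \<sigma> = 1 \<and> f \<sigma> id = 1)"

text \<open>Elements of the crossed product algebra (K/F,G,f) = sum over sigma of K x_sigma are
  represented by their coefficient functions a : G \<rightarrow> K (zero outside G), i.e.
  a corresponds to sum over sigma in G of a(sigma) x_sigma.\<close>
definition cp_carrier :: "('k::field \<Rightarrow> 'k) set \<Rightarrow> (('k \<Rightarrow> 'k) \<Rightarrow> 'k) set" where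
  "cp_carrier G = {a. \<forall>\<sigma>. \<sigma> \<notin> G \<longrightarrow> a \<sigma> = 0}"

definition cp_add :: "(('k::field \<Rightarrow> 'k) \<Rightarrow> 'k) \<Rightarrow> (('k \<Rightarrow> 'k) \<Rightarrow> 'k) \<Rightarrow> (('k \<Rightarrow> 'k) \<Rightarrow> 'k)" where
  "cp_add a b = (\<lambda>\<rho>. a \<rho> + b \<rho>)"

definition cp_neg :: "(('k::field \<Rightarrow> 'k) \<Rightarrow> 'k) \<Rightarrow> (('k \<Rightarrow> 'k) \<Rightarrow> 'k)" where
  "cp_neg a = (\<lambda>\<rho>. - a \<rho>)"

text \<open>(s x_sigma)(t x_tau) = s sigma(t) f(sigma,tau) x_(sigma tau), extended bilinearly.\<close>
definition cp_mult ::
  "('k::field \<Rightarrow> 'k) set \<Rightarrow> (('k \<Rightarrow> 'k) \<Rightarrow> ('k \<Rightarrow> 'k) \<Rightarrow> 'k)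
     \<Rightarrow> (('k \<Rightarrow> 'k) \<Rightarrow> 'k) \<Rightarrow> (('k \<Rightarrow> 'k) \<Rightarrow> 'k) \<Rightarrow> (('k \<Rightarrow> 'k) \<Rightarrow> 'k)" where
  "cp_mult G f a b = (\<lambda>\<rho>. if \<rho> \<in> G then
      (\<Sum>\<sigma>\<in>G. a \<sigma> * \<sigma> (b (inv \<sigma> \<circ> \<rho>)) * f \<sigma> (inv \<sigma> \<circ> \<rho>)) else 0)"

definition cp_order :: "('k::field \<Rightarrow> 'k) set \<Rightarrow> 'k set \<Rightarrow> (('k \<Rightarrow> 'k) \<Rightarrow> 'k) set" where
  "cp_order G S = {a \<in> cp_carrier G. \<forall>\<sigma>\<in>G. a \<sigma> \<in> S}"

definition cp_component :: "(('k::field \<Rightarrow> 'k) \<Rightarrow> 'k) \<Rightarrow> ('k \<Rightarrow> 'k) \<Rightarrow> (('k \<Rightarrow> 'k) \<Rightarrow> 'k)" where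
  "cp_component a \<sigma> = (\<lambda>\<rho>. if \<rho> = \<sigma> then a \<sigma> else 0)"

definition graded_left_ideal ::
  "('k::field \<Rightarrow> 'k) set \<Rightarrow> 'k set \<Rightarrow> (('k \<Rightarrow> 'k) \<Rightarrow> ('k \<Rightarrow> 'k) \<Rightarrow> 'k)
     \<Rightarrow> (('k \<Rightarrow> 'k) \<Rightarrow> 'k) set \<Rightarrow> bool" where
  "graded_left_ideal G S f I \<longleftrightarrow> I \<subseteq> cp_order G S \<and> (\<lambda>_. 0) \<in> I
     \<and> (\<forall>a\<in>I. \<forall>b\<in>I. cp_add a b \<in> I) \<and> (\<forall>a\<in>I. cp_neg a \<in> I)
     \<and> (\<forall>r\<in>cp_order G S. \<forall>a\<in>I. cp_mult G f r a \<in> I)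
     \<and> (\<forall>a\<in>I. \<forall>\<sigma>\<in>G. cp_component a \<sigma> \<in> I)"

definition maximal_graded_left_ideal ::
  "('k::field \<Rightarrow> 'k) set \<Rightarrow> 'k set \<Rightarrow> (('k \<Rightarrow> 'k) \<Rightarrow> ('k \<Rightarrow> 'k) \<Rightarrow> 'k)
     \<Rightarrow> (('k \<Rightarrow> 'k) \<Rightarrow> 'k) set \<Rightarrow> bool" where
  "maximal_graded_left_ideal G S f I \<longleftrightarrow> graded_left_ideal G S f I \<and> I \<noteq> cp_order G S
     \<and> (\<forall>J. graded_left_ideal G S f J \<and> I \<subseteq> J \<longrightarrow> J = I \<or> J = cp_order G S)"

definition graded_jacobson ::
  "('k::field \<Rightarrow> 'k) set \<Rightarrow> 'k set \<Rightarrow> (('k \<Rightarrow> 'k) \<Rightarrow> ('k \<Rightarrow> 'k) \<Rightarrow> 'k)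
     \<Rightarrow> (('k \<Rightarrow> 'k) \<Rightarrow> 'k) set" where
  "graded_jacobson G S f = {x \<in> cp_order G S.
      \<forall>I. maximal_graded_left_ideal G S f I \<longrightarrow> x \<in> I}"

definition left_order ::
  "('k::field \<Rightarrow> 'k) set \<Rightarrow> (('k \<Rightarrow> 'k) \<Rightarrow> ('k \<Rightarrow> 'k) \<Rightarrow> 'k)
     \<Rightarrow> (('k \<Rightarrow> 'k) \<Rightarrow> 'k) set \<Rightarrow> (('k \<Rightarrow> 'k) \<Rightarrow> 'k) set" where
  "left_order G f I = {x \<in> cp_carrier G. \<forall>y\<in>I. cp_mult G f x y \<in> I}"

end

theory Submission
  imports Defs "HOL-Computational_Algebra.Polynomial"
begin

text \<open>
  \<^emph>\<open>The ring \<open>S\<close>.\<close> Let \<open>J(V) = pV\<close>. If \<open>p = 0\<close> then \<open>S = K\<close> and everything is trivial, so let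
  \<open>p \<noteq> 0\<close>. By Chevalley's theorem \<open>V\<close> extends to a valuation ring of \<open>K\<close>, and \<open>S\<close> is the
  intersection of its conjugates; hence \<open>S\<close> is a Pruefer domain. Its maximal ideals are conjugate,
  so finite in number. A power \<open>x\<^sup>n\<close> of each \<open>x \<in> M\<close>, \<open>n = |G|\<close>, is locally divisible by \<open>p\<close>, so
  the valuation at \<open>M\<close> has a least positive value; it follows that every maximal ideal \<open>M\<close> is
  invertible.

  \<^emph>\<open>The radical.\<close> The maximal graded left ideals are the largest graded left ideals with component
  \<open>M\<close> in degree one, for \<open>M\<close> maximal in \<open>S\<close>. Hence the \<open>\<sigma>\<close>-component of \<open>J\<^sub>G(A\<^sub>f)\<close> consists of
  the \<open>s \<in> S\<close> with \<open>s f(\<sigma>, \<sigma>\<^sup>-\<^sup>1) \<in> J(S)\<close>.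

  \<^emph>\<open>The left order.\<close> If no \<open>f(\<sigma>, \<sigma>\<^sup>-\<^sup>1)\<close> lies in an \<open>M\<^sup>2\<close>, invertibility gives
  \<open>J(S) \<subseteq> f(\<sigma>, \<sigma>\<^sup>-\<^sup>1) S\<close>, so the coefficients \<open>k\<close> of an element of the left order satisfy
  \<open>k J(S) \<subseteq> J(S)\<close>, whence \<open>k \<in> S\<close>. Conversely, if \<open>f(\<sigma>, \<sigma>\<^sup>-\<^sup>1) \<in> M\<^sup>2\<close>, then for a suitably
  extremal such \<open>\<sigma>\<close> and any \<open>k\<close> with \<open>k M \<subseteq> S\<close> the element \<open>k x\<^sub>\<sigma>\<close> lies in the left order.
\<close>

subsection \<open>Extension of valuation rings\<close>

lemma subring_zero: "subring_of R \<Longrightarrow> 0 \<in> R"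
  and subring_one: "subring_of R \<Longrightarrow> 1 \<in> R"
  and subring_add: "subring_of R \<Longrightarrow> x \<in> R \<Longrightarrow> y \<in> R \<Longrightarrow> x + y \<in> R"
  and subring_mult: "subring_of R \<Longrightarrow> x \<in> R \<Longrightarrow> y \<in> R \<Longrightarrow> x * y \<in> R"
  and subring_uminus: "subring_of R \<Longrightarrow> x \<in> R \<Longrightarrow> - x \<in> R"
  by (auto simp: subring_of_def)

lemma subring_diff: "subring_of R \<Longrightarrow> x \<in> R \<Longrightarrow> y \<in> R \<Longrightarrow> x - y \<in> R"
  by (metis diff_conv_add_uminus subring_add subring_uminus)

lemma subring_power: "subring_of R \<Longrightarrow> x \<in> R \<Longrightarrow> x ^ n \<in> R"
  by (induction n) (auto intro: subring_one subring_mult)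

lemma subring_sum: "subring_of R \<Longrightarrow> (\<And>i. i \<in> A \<Longrightarrow> g i \<in> R) \<Longrightarrow> sum g A \<in> R"
  by (induction A rule: infinite_finite_induct) (auto intro: subring_zero subring_add)

lemma subring_prod: "subring_of R \<Longrightarrow> (\<And>i. i \<in> A \<Longrightarrow> g i \<in> R) \<Longrightarrow> prod g A \<in> R"
  by (induction A rule: infinite_finite_induct) (auto intro: subring_one subring_mult)

lemmas subring_closed =
  subring_zero subring_one subring_add subring_mult subring_uminus subring_diff
  subring_power subring_sum subring_prod

lemma subring_INT: "(\<And>i. i \<in> I \<Longrightarrow> subring_of (R i)) \<Longrightarrow> subring_of (\<Inter>i\<in>I. R i)"
  by (auto simp: subring_of_def)

text \<open>This is \<open>R[x]\<close>. Subrings are sets here, so its elements are values of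
  polynomials over the whole ring whose coefficients are constrained to \<open>R\<close>.\<close>

definition adjoin :: "'a::comm_ring_1 set \<Rightarrow> 'a \<Rightarrow> 'a set" where
  "adjoin R x = {poly q x | q. \<forall>i. coeff q i \<in> R}"

lemma subring_adjoin:
  assumes R: "subring_of R"
  shows "subring_of (adjoin R x)"
proof -
  have "0 \<in> adjoin R x"
    unfolding adjoin_def using subring_zero[OF R] by (force intro: exI[of _ 0])
  moreover have "1 \<in> adjoin R x"
    unfolding adjoin_def using subring_zero[OF R] subring_one[OF R]
    by (force intro!: exI[of _ 1] simp: coeff_1)
  moreover have "a + b \<in> adjoin R x" "a * b \<in> adjoin R x" if "a \<in> adjoin R x" "b \<in> adjoin R x" for a b
  proof -
    from that obtain p q where pq: "a = poly p x" "b = poly q x"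
      "\<And>i. coeff p i \<in> R" "\<And>i. coeff q i \<in> R" by (auto simp: adjoin_def)
    have "\<forall>i. coeff (p + q) i \<in> R" "\<forall>i. coeff (p * q) i \<in> R"
      using pq R by (auto simp: coeff_mult intro!: subring_closed)
    then show "a + b \<in> adjoin R x" "a * b \<in> adjoin R x"
      unfolding adjoin_def pq by (auto simp flip: poly_add poly_mult)
  qed
  moreover have "- a \<in> adjoin R x" if "a \<in> adjoin R x" for a
  proof -
    from that obtain p where p: "a = poly p x" "\<And>i. coeff p i \<in> R" by (auto simp: adjoin_def)
    have "\<forall>i. coeff (- p) i \<in> R"
      using p R by (auto intro!: subring_closed)
    then show "- a \<in> adjoin R x"
      unfolding adjoin_def p by (auto simp flip: poly_minus)
  qed
  ultimately show ?thesis by (auto simp: subring_of_def)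
qed

lemma adjoin_superset: "subring_of R \<Longrightarrow> R \<subseteq> adjoin R x"
proof
  fix r assume "subring_of R" "r \<in> R"
  then show "r \<in> adjoin R x"
    unfolding adjoin_def
    by (auto intro!: exI[of _ "[:r:]"] simp: coeff_pCons subring_zero split: nat.splits)
qed

lemma adjoin_mem: "subring_of R \<Longrightarrow> x \<in> adjoin R x"
  unfolding adjoin_def
  by (auto intro!: exI[of _ "[:0, 1:]"] simp: coeff_pCons subring_zero subring_one split: nat.splits)

lemma subring_Union_chain:
  assumes C: "C \<noteq> {}" "\<And>R. R \<in> C \<Longrightarrow> subring_of R"
    and ch: "\<And>R T. R \<in> C \<Longrightarrow> T \<in> C \<Longrightarrow> R \<subseteq> T \<or> T \<subseteq> R"
  shows "subring_of (\<Union>C)"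
proof -
  have "x + y \<in> \<Union>C \<and> x * y \<in> \<Union>C" if "x \<in> \<Union>C" "y \<in> \<Union>C" for x y
  proof -
    from that obtain R T where RT: "R \<in> C" "T \<in> C" "x \<in> R" "y \<in> T" by auto
    then obtain U where "U \<in> C" "x \<in> U" "y \<in> U" using ch[of R T] by blast
    then show ?thesis using C(2)[of U] by (auto intro: subring_closed)
  qed
  moreover have "- x \<in> \<Union>C" if "x \<in> \<Union>C" for x
    using that C(2) subring_uminus by blast
  moreover have "0 \<in> \<Union>C" "1 \<in> \<Union>C"
    using C subring_zero subring_one by blast+
  ultimately show ?thesis
    unfolding subring_of_def by blast
qed

text \<open>The minimal-degree exchange of Chevalley's theorem: a relation of degree \<open>m\<close> for \<open>1/x\<close>,
  divided by its unit \<open>1 - p b\<^sub>0\<close>, lowers the degree of a relation for \<open>x\<close> of degree \<open>n \<ge> m\<close>.\<close>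

lemma relation_degree_lower:
  fixes x p :: "'k::field"
  assumes R: "subring_of R" and p: "p \<in> R" and x: "x \<noteq> 0"
    and unit: "\<And>b. b \<in> R \<Longrightarrow> 1 - p * b \<noteq> 0 \<and> inverse (1 - p * b) \<in> R"
    and a: "\<And>i. a i \<in> R" "p * (\<Sum>i\<le>n. a i * x ^ i) = 1"
    and b: "\<And>i. b i \<in> R" "p * (\<Sum>j\<le>m. b j * inverse x ^ j) = 1"
    and mn: "m \<le> n" "0 < n"
  shows "\<exists>c. (\<forall>i. c i \<in> R) \<and> p * (\<Sum>i\<le>n - 1. c i * x ^ i) = 1"
proof -
  define u where "u = 1 - p * b 0"
  have u: "u \<noteq> 0" "inverse u \<in> R" using unit[OF b(1)[of 0]] by (auto simp: u_def)
  have "(\<Sum>j\<le>m. b j * inverse x ^ j) = b 0 + (\<Sum>j\<in>{1..m}. b j * inverse x ^ j)"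
    by (simp add: sum.atLeast_Suc_atMost flip: atLeast0AtMost)
  with b(2) have e1: "p * (\<Sum>j\<in>{1..m}. b j * inverse x ^ j) = u"
    by (simp add: u_def algebra_simps)
  define d where "d = (\<lambda>i. if i < n \<and> n - i \<le> m then inverse u * b (n - i) else 0)"
  have d: "d i \<in> R" for i using u b R by (auto simp: d_def intro: subring_closed)
  have "p * (\<Sum>i<n. d i * x ^ i) = x ^ n"
  proof -
    have "(\<Sum>i<n. d i * x ^ i) = (\<Sum>i\<in>{i. i < n \<and> n - i \<le> m}. inverse u * b (n - i) * x ^ i)"
      by (rule sum.mono_neutral_cong_right) (auto simp: d_def)
    also have "\<dots> = (\<Sum>j\<in>{1..m}. inverse u * b j * x ^ (n - j))"
      by (rule sum.reindex_bij_witness[of _ "\<lambda>j. n - j" "\<lambda>i. n - i"]) (use mn in auto)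
    also have "\<dots> = (\<Sum>j\<in>{1..m}. x ^ n * inverse u * (b j * inverse x ^ j))"
    proof (rule sum.cong[OF refl])
      fix j assume "j \<in> {1..m}"
      then have "j \<le> n" using mn by auto
      then have "x ^ (n - j) = x ^ n * inverse x ^ j"
        using x by (simp add: power_diff field_simps)
      then show "inverse u * b j * x ^ (n - j) = x ^ n * inverse u * (b j * inverse x ^ j)" by simp
    qed
    also have "\<dots> = x ^ n * inverse u * (\<Sum>j\<in>{1..m}. b j * inverse x ^ j)"
      by (simp add: sum_distrib_left)
    finally have "p * (\<Sum>i<n. d i * x ^ i)
        = x ^ n * inverse u * (p * (\<Sum>j\<in>{1..m}. b j * inverse x ^ j))"
      by (simp add: mult_ac)
    then show ?thesis using u unfolding e1 by simp
  qed
  then have xn: "x ^ n = p * (\<Sum>i<n. d i * x ^ i)" by simp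
  have Sn: "{..n} = insert n {..<n}" using mn by auto
  have "1 = p * (a n * x ^ n + (\<Sum>i<n. a i * x ^ i))"
    using a(2) unfolding Sn by simp
  also have "\<dots> = p * ((\<Sum>i<n. (a n * p * d i) * x ^ i) + (\<Sum>i<n. a i * x ^ i))"
    unfolding xn by (simp add: sum_distrib_left mult.assoc)
  also have "\<dots> = p * (\<Sum>i<n. (a n * p * d i + a i) * x ^ i)"
    by (simp add: sum.distrib algebra_simps)
  also have "{..<n} = {..n - 1}" using mn by auto
  finally show ?thesis
    using a d p R by (intro exI[of _ "\<lambda>i. a n * p * d i + a i"]) (auto intro!: subring_closed)
qed

text \<open>Chevalley's argument: Zorn's lemma gives an overring \<open>R\<close> of
  \<open>V\<close> maximal among those in which \<open>p\<close> stays a nonunit. If neither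
  \<open>x\<close> nor its inverse were in \<open>R\<close>, adjoining either one would make
  \<open>p\<close> invertible, and the two resulting relations can be shortened against each other
  until \<open>p\<close> is a unit of \<open>R\<close> itself.\<close>

lemma valuation_ring_extension:
  fixes V :: "'k::field set"
  assumes V: "subring_of V" and pV: "p \<in> V" and nonunit: "\<And>v. v \<in> V \<Longrightarrow> p * v \<noteq> 1"
  obtains W where "subring_of W" "V \<subseteq> W" "\<And>w. w \<in> W \<Longrightarrow> p * w \<noteq> 1"
    "\<And>x. x \<in> W \<or> inverse x \<in> W"
proof -
  define A where "A = {R. subring_of R \<and> V \<subseteq> R \<and> (\<forall>r\<in>R. p * r \<noteq> 1)}"
  have "V \<in> A" using assms by (auto simp: A_def)
  have "\<exists>M\<in>A. \<forall>X\<in>A. M \<subseteq> X \<longrightarrow> X = M"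
  proof (rule subset_Zorn_nonempty)
    show "A \<noteq> {}" using \<open>V \<in> A\<close> by auto
    fix C assume C: "C \<noteq> {}" "subset.chain A C"
    then have "subring_of (\<Union>C)"
      by (intro subring_Union_chain) (auto 0 3 simp: A_def subset_chain_def)
    then show "\<Union>C \<in> A" using C by (auto simp: A_def subset.chain_def)
  qed
  then obtain R where RA: "R \<in> A" and Rmax: "\<And>X. X \<in> A \<Longrightarrow> R \<subseteq> X \<Longrightarrow> X = R" by blast
  have R: "subring_of R" "V \<subseteq> R" and Rn: "\<And>r. r \<in> R \<Longrightarrow> p * r \<noteq> 1"
    using RA by (auto simp: A_def)
  have pR: "p \<in> R" using R pV by auto
  \<comment> \<open>Maximality of \<open>R\<close> means that \<open>p\<close> becomes invertible in
    \<open>R[x]\<close>; its inverse, written as a polynomial in \<open>x\<close>, is the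
    relation.\<close>
  have rel: "\<exists>n a. (\<forall>i. a i \<in> R) \<and> p * (\<Sum>i\<le>n. a i * x ^ i) = 1" if "x \<notin> R" for x
  proof -
    have "adjoin R x \<notin> A"
      using Rmax[of "adjoin R x"] adjoin_superset[OF R(1)] adjoin_mem[OF R(1), of x] that by auto
    then obtain r where r: "r \<in> adjoin R x" "p * r = 1"
      using subring_adjoin[OF R(1)] adjoin_superset[OF R(1), of x] R(2) by (auto simp: A_def)
    then obtain q where "r = poly q x" "\<forall>i. coeff q i \<in> R" by (auto simp: adjoin_def)
    with r(2) show ?thesis
      by (intro exI[of _ "degree q"] exI[of _ "coeff q"]) (simp add: poly_altdef)
  qed
  \<comment> \<open>Were the inverse of \<open>u = 1 - p * b\<close> not in \<open>R\<close>, the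
    relation for it, multiplied by \<open>u ^ n\<close>, would put \<open>u ^ n\<close> into
    \<open>p R\<close>. But \<open>u ^ n\<close> is congruent to \<open>1\<close> modulo
    \<open>p R\<close>, so \<open>1\<close> would lie in \<open>p R\<close>.\<close>
  have unit: "1 - p * b \<noteq> 0 \<and> inverse (1 - p * b) \<in> R" if b: "b \<in> R" for b
  proof (rule conjI)
    define u where "u = 1 - p * b"
    show "1 - p * b \<noteq> 0" using Rn[OF b] by auto
    then have u0: "u \<noteq> 0" by (simp add: u_def)
    have uR: "u \<in> R" unfolding u_def using b pR R by (auto intro!: subring_closed)
    show "inverse (1 - p * b) \<in> R"
    proof (rule ccontr)
      assume "inverse (1 - p * b) \<notin> R"
      from rel[OF this] obtain n a where a: "\<forall>i. a i \<in> R" "p * (\<Sum>i\<le>n. a i * inverse u ^ i) = 1"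
        unfolding u_def by blast
      have "u ^ n = p * (\<Sum>i\<le>n. a i * inverse u ^ i) * u ^ n" using a by simp
      also have "\<dots> = p * (\<Sum>i\<le>n. a i * (inverse u ^ i * u ^ n))"
        by (simp add: sum_distrib_right mult.assoc)
      also have "\<dots> = p * (\<Sum>i\<le>n. a i * u ^ (n - i))"
        using u0 by (intro arg_cong[of _ _ "\<lambda>z. p * z"] sum.cong) (auto simp: power_diff field_simps)
      finally have un: "u ^ n = p * (\<Sum>i\<le>n. a i * u ^ (n - i))" .
      have "\<exists>c\<in>R. u ^ n = 1 - p * c"
      proof (induction n)
        case 0
        then show ?case using R by (auto intro!: bexI[of _ 0] subring_closed)
      next
        case (Suc n)
        then obtain c where c: "c \<in> R" "u ^ n = 1 - p * c" by auto
        have "u ^ Suc n = (1 - p * b) * (1 - p * c)" using c(2) by (simp add: u_def)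
        also have "\<dots> = 1 - p * (c + b - p * b * c)" by (simp add: algebra_simps)
        finally have "u ^ Suc n = 1 - p * (c + b - p * b * c)" .
        moreover have "c + b - p * b * c \<in> R"
          using c(1) b pR by (intro subring_diff subring_add subring_mult R(1))
        ultimately show ?case by blast
      qed
      then obtain c where c: "c \<in> R" "u ^ n = 1 - p * c" by auto
      have "p * (c + (\<Sum>i\<le>n. a i * u ^ (n - i))) = 1"
        using un c by (simp add: algebra_simps)
      moreover have "c + (\<Sum>i\<le>n. a i * u ^ (n - i)) \<in> R"
        using c a R uR by (auto intro!: subring_closed)
      ultimately show False using Rn by blast
    qed
  qed
  \<comment> \<open>Descent on the sum of the two degrees: the longer relation loses a degree, with
    \<open>x\<close> and its inverse exchanging roles when \<open>m > n\<close>. A relation of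
    degree \<open>0\<close> says that \<open>p\<close> is a unit of \<open>R\<close>.\<close>
  have no: False
    if "x \<noteq> 0" "\<And>i. a i \<in> R" "p * (\<Sum>i\<le>n. a i * x ^ i) = 1"
      "\<And>i. b i \<in> R" "p * (\<Sum>j\<le>m. b j * inverse x ^ j) = 1" for x a b n m
    using that
  proof (induction "n + m" arbitrary: n m a b x rule: less_induct)
    case less
    have n0: "n > 0"
    proof (rule ccontr)
      assume "\<not> n > 0"
      then have "p * a 0 = 1" using less.prems(3) by simp
      then show False using Rn less.prems(2) by blast
    qed
    have m0: "m > 0"
    proof (rule ccontr)
      assume "\<not> m > 0"
      then have "p * b 0 = 1" using less.prems(5) by simp
      then show False using Rn less.prems(4) by blast
    qed
    show False
    proof (cases "m \<le> n")
      case True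
      from relation_degree_lower[OF R(1) pR less.prems(1) unit less.prems(2,3,4,5) True n0]
      obtain c where "\<forall>i. c i \<in> R" "p * (\<Sum>i\<le>n - 1. c i * x ^ i) = 1" by auto
      with less.hyps[of "n - 1" m x c b] less.prems n0 show False by auto
    next
      case False
      have x': "inverse x \<noteq> 0" "p * (\<Sum>i\<le>n. a i * inverse (inverse x) ^ i) = 1"
        using less.prems by auto
      from relation_degree_lower[OF R(1) pR x'(1) unit less.prems(4,5,2) x'(2)] False m0
      obtain c where "\<forall>i. c i \<in> R" "p * (\<Sum>i\<le>m - 1. c i * inverse x ^ i) = 1" by auto
      with less.hyps[of n "m - 1" x a c] less.prems m0 show False by auto
    qed
  qed
  have "x \<in> R \<or> inverse x \<in> R" for x
  proof (rule ccontr)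
    assume *: "\<not> (x \<in> R \<or> inverse x \<in> R)"
    then have "x \<noteq> 0" using R subring_zero by auto
    moreover from * rel[of x] obtain n a where "\<forall>i. a i \<in> R" "p * (\<Sum>i\<le>n. a i * x ^ i) = 1" by auto
    moreover from * rel[of "inverse x"] obtain m b where
      "\<forall>i. b i \<in> R" "p * (\<Sum>i\<le>m. b i * inverse x ^ i) = 1" by auto
    ultimately show False using no[of x a n b m] by auto
  qed
  then show thesis using that[of R] R Rn by blast
qed

subsection \<open>The integral closure of a valuation ring in a Galois extension\<close>

lemma field_aut_add: "is_field_aut \<sigma> \<Longrightarrow> \<sigma> (x + y) = \<sigma> x + \<sigma> y"
  and field_aut_mult: "is_field_aut \<sigma> \<Longrightarrow> \<sigma> (x * y) = \<sigma> x * \<sigma> y"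
  and field_aut_one: "is_field_aut \<sigma> \<Longrightarrow> \<sigma> 1 = 1"
  and field_aut_bij: "is_field_aut \<sigma> \<Longrightarrow> bij \<sigma>"
  by (auto simp: is_field_aut_def)

lemma field_aut_zero: "is_field_aut \<sigma> \<Longrightarrow> \<sigma> 0 = 0"
  by (metis add.right_neutral add_left_cancel field_aut_add)

context
  fixes \<sigma> :: "'k::field \<Rightarrow> 'k"
  assumes aut: "is_field_aut \<sigma>"
begin

lemma field_aut_uminus: "\<sigma> (- x) = - \<sigma> x"
  using field_aut_add[OF aut, of x "- x"]
  by (simp add: field_aut_zero[OF aut] eq_neg_iff_add_eq_0 add.commute)

lemma field_aut_diff: "\<sigma> (x - y) = \<sigma> x - \<sigma> y"
  using field_aut_add[OF aut, of x "- y"] by (simp add: field_aut_uminus)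

lemma field_aut_inverse: "\<sigma> (inverse x) = inverse (\<sigma> x)"
proof (cases "x = 0")
  case False
  have "\<sigma> x * \<sigma> (inverse x) = 1"
    using False by (simp add: field_aut_one[OF aut] flip: field_aut_mult[OF aut])
  then show ?thesis by (rule inverse_unique[symmetric])
qed (simp add: field_aut_zero[OF aut])

lemma field_aut_power: "\<sigma> (x ^ n) = \<sigma> x ^ n"
  by (induction n) (auto simp: field_aut_one[OF aut] field_aut_mult[OF aut])

lemma field_aut_sum: "\<sigma> (sum g A) = (\<Sum>i\<in>A. \<sigma> (g i))"
  by (induction A rule: infinite_finite_induct)
    (auto simp: field_aut_zero[OF aut] field_aut_add[OF aut])

lemma field_aut_prod: "\<sigma> (prod g A) = (\<Prod>i\<in>A. \<sigma> (g i))"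
  by (induction A rule: infinite_finite_induct)
    (auto simp: field_aut_one[OF aut] field_aut_mult[OF aut])

end

lemmas field_aut_simps = field_aut_add field_aut_mult field_aut_one field_aut_zero field_aut_uminus
  field_aut_diff field_aut_inverse field_aut_power field_aut_sum field_aut_prod

lemma subring_vimage_aut: "is_field_aut \<sigma> \<Longrightarrow> subring_of R \<Longrightarrow> subring_of (\<sigma> -` R)"
proof -
  assume \<sigma>: "is_field_aut \<sigma>" and R: "subring_of R"
  show ?thesis
    using R unfolding subring_of_def by (simp add: field_aut_simps[OF \<sigma>])
qed

lemma coeff_linear_factor_mult:
  "coeff ([:- c :: 'a::comm_ring_1, 1:] * q) n = - c * coeff q n + (case n of 0 \<Rightarrow> 0 | Suc m \<Rightarrow> coeff q m)"
  by (cases n) (simp_all add: coeff_pCons)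

lemma coeff_prod_linear_aut:
  assumes "is_field_aut \<tau>"
  shows "coeff (\<Prod>i\<in>A. [:- \<tau> (g i), 1:]) n = \<tau> (coeff (\<Prod>i\<in>A. [:- g i, 1:]) n)"
proof (induction A arbitrary: n rule: infinite_finite_induct)
  case (insert i A)
  then show ?case
    by (simp add: prod.insert coeff_linear_factor_mult field_aut_simps[OF assms] del: mult_pCons_left
        split: nat.splits)
qed (auto simp: coeff_1 field_aut_simps[OF assms])

lemma coeff_prod_linear_in_subring:
  assumes "subring_of R" "\<And>i. i \<in> A \<Longrightarrow> g i \<in> R"
  shows "coeff (\<Prod>i\<in>A. [:- g i, 1:]) n \<in> R"
  using assms(2)
proof (induction A arbitrary: n rule: infinite_finite_induct)
  case (insert i A)
  then show ?case
    using assms(1)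
    by (auto simp: prod.insert coeff_linear_factor_mult simp del: mult_pCons_left mult_minus_left
        split: nat.splits intro!: subring_closed)
qed (use assms(1) in \<open>auto simp: coeff_1 intro: subring_closed\<close>)

text \<open>If \<open>y\<close> were outside \<open>W\<close>, its inverse would be in
  \<open>W\<close>; dividing the integral equation by \<open>y ^ (n - 1)\<close> writes
  \<open>y\<close> as a polynomial in that inverse over \<open>W\<close>.\<close>

lemma valuation_ring_integrally_closed:
  fixes y :: "'k::field"
  assumes W: "subring_of W" and val: "\<And>x. x \<in> W \<or> inverse x \<in> W"
    and c: "\<And>i. i < n \<Longrightarrow> c i \<in> W" and eq: "y ^ n + (\<Sum>i<n. c i * y ^ i) = 0"
  shows "y \<in> W"
proof (rule ccontr)
  assume y: "y \<notin> W"
  then have z: "inverse y \<in> W" and y0: "y \<noteq> 0" using val[of y] subring_zero[OF W] by auto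
  have n0: "n > 0" using eq by (cases n) auto
  have "y = y ^ n * inverse y ^ (n - 1)"
    using y0 n0 by (cases n) (auto simp: field_simps)
  also have "y ^ n = - (\<Sum>i<n. c i * y ^ i)" using eq by (simp add: eq_neg_iff_add_eq_0)
  also have "\<dots> * inverse y ^ (n - 1) = - (\<Sum>i<n. c i * (y ^ i * inverse y ^ (n - 1)))"
    by (simp add: sum_distrib_right mult.assoc)
  also have "\<dots> = - (\<Sum>i<n. c i * inverse y ^ (n - 1 - i))"
    using y0 by (intro arg_cong[of _ _ uminus] sum.cong) (auto simp: power_diff field_simps)
  also have "\<dots> \<in> W" using c z W by (auto intro!: subring_closed)
  finally show False using y by simp
qed

section \<open>Finite automorphism groups and characteristic polynomials\<close>

locale aut_group =
  fixes G :: "('k::field \<Rightarrow> 'k) set"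
  assumes finite_aut_group: "finite_aut_group G"
begin

lemma finite_G: "finite G"
  and id_in_G [simp, intro]: "id \<in> G"
  and comp_in_G [simp, intro]: "\<sigma> \<in> G \<Longrightarrow> \<tau> \<in> G \<Longrightarrow> \<sigma> \<circ> \<tau> \<in> G"
  and inv_in_G [simp, intro]: "\<sigma> \<in> G \<Longrightarrow> inv \<sigma> \<in> G"
  and aut_G: "\<sigma> \<in> G \<Longrightarrow> is_field_aut \<sigma>"
  using finite_aut_group by (auto simp: finite_aut_group_def)

lemma bij_G: "\<sigma> \<in> G \<Longrightarrow> bij \<sigma>"
  by (simp add: aut_G field_aut_bij)

lemma inv_apply [simp]: "\<sigma> \<in> G \<Longrightarrow> inv \<sigma> (\<sigma> x) = x"
  and apply_inv [simp]: "\<sigma> \<in> G \<Longrightarrow> \<sigma> (inv \<sigma> x) = x"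
  using bij_G by (simp_all add: bij_is_inj bij_is_surj surj_f_inv_f)

lemma inv_comp [simp]: "\<sigma> \<in> G \<Longrightarrow> inv \<sigma> \<circ> \<sigma> = id"
  and comp_inv [simp]: "\<sigma> \<in> G \<Longrightarrow> \<sigma> \<circ> inv \<sigma> = id"
  and inv_comp_cancel [simp]: "\<sigma> \<in> G \<Longrightarrow> inv \<sigma> \<circ> (\<sigma> \<circ> \<tau>) = \<tau>"
  and comp_inv_cancel [simp]: "\<sigma> \<in> G \<Longrightarrow> \<sigma> \<circ> (inv \<sigma> \<circ> \<tau>) = \<tau>"
  by (auto simp: fun_eq_iff)

lemma inv_inv [simp]: "\<sigma> \<in> G \<Longrightarrow> inv (inv \<sigma>) = \<sigma>"
  by (simp add: bij_G inv_inv_eq)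

lemma inv_comp_distrib: "\<sigma> \<in> G \<Longrightarrow> \<tau> \<in> G \<Longrightarrow> inv (\<sigma> \<circ> \<tau>) = inv \<tau> \<circ> inv \<sigma>"
  by (simp add: bij_G o_inv_distrib)

lemma comp_bij_betw: "\<sigma> \<in> G \<Longrightarrow> bij_betw (\<lambda>\<tau>. \<sigma> \<circ> \<tau>) G G"
  by (rule bij_betw_byWitness[of _ "\<lambda>\<tau>. inv \<sigma> \<circ> \<tau>"]) auto

lemma subring_fixed_field: "subring_of (fixed_field G)"
proof -
  have "subring_of {x. \<sigma> x = x}" if "\<sigma> \<in> G" for \<sigma>
    unfolding subring_of_def by (simp add: field_aut_simps[OF aut_G[OF that]])
  then have "subring_of (\<Inter>\<sigma>\<in>G. {x. \<sigma> x = x})" by (rule subring_INT)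
  also have "(\<Inter>\<sigma>\<in>G. {x. \<sigma> x = x}) = fixed_field G" by (auto simp: fixed_field_def)
  finally show ?thesis .
qed

lemma inverse_fixed_field: "x \<in> fixed_field G \<Longrightarrow> inverse x \<in> fixed_field G"
  by (simp add: fixed_field_def aut_G field_aut_inverse)

lemma fixed_fieldD: "x \<in> fixed_field G \<Longrightarrow> \<sigma> \<in> G \<Longrightarrow> \<sigma> x = x"
  by (auto simp: fixed_field_def)

text \<open>The characteristic polynomial of \<open>x\<close> over the fixed field, a power of its
  minimal polynomial. Its degree is \<open>card G\<close> for every \<open>x\<close>, which later
  supplies one exponent valid for all elements.\<close>

definition charpoly :: "'k \<Rightarrow> 'k poly" where
  "charpoly x = (\<Prod>\<sigma>\<in>G. [:- \<sigma> x, 1:])"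

text \<open>Applying \<open>\<tau>\<close> to the coefficients only permutes the linear
  factors.\<close>

lemma charpoly_coeff_fixed: "coeff (charpoly x) i \<in> fixed_field G"
proof -
  have "\<tau> (coeff (charpoly x) i) = coeff (charpoly x) i" if \<tau>: "\<tau> \<in> G" for \<tau>
  proof -
    have "\<tau> (coeff (charpoly x) i) = coeff (\<Prod>\<sigma>\<in>G. [:- \<tau> (\<sigma> x), 1:]) i"
      unfolding charpoly_def by (rule coeff_prod_linear_aut[OF aut_G[OF \<tau>], symmetric])
    also have "(\<Prod>\<sigma>\<in>G. [:- \<tau> (\<sigma> x), 1:]) = (\<Prod>\<sigma>\<in>G. [:- (\<tau> \<circ> \<sigma>) x, 1:])" by simp
    also have "\<dots> = charpoly x"
      unfolding charpoly_def by (rule prod.reindex_bij_betw[OF comp_bij_betw[OF \<tau>]])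
    finally show ?thesis .
  qed
  then show ?thesis by (auto simp: fixed_field_def)
qed

lemma degree_charpoly: "degree (charpoly x) = card G"
  unfolding charpoly_def by (subst degree_prod_eq_sum_degree) auto

lemma coeff_charpoly_top: "coeff (charpoly x) (card G) = 1"
proof -
  have "lead_coeff (charpoly x) = 1"
    unfolding charpoly_def by (simp add: lead_coeff_prod)
  then show ?thesis by (simp add: degree_charpoly)
qed

lemma charpoly_eq_0: "(\<Sum>i\<le>card G. coeff (charpoly x) i * x ^ i) = 0"
proof -
  have "poly (charpoly x) x = (\<Prod>\<sigma>\<in>G. x - \<sigma> x)"
    by (simp add: charpoly_def poly_prod)
  also have "\<dots> = 0" by (rule prod_zero[OF finite_G]) (auto intro: bexI[of _ id])
  finally show ?thesis by (simp add: poly_altdef degree_charpoly)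
qed

lemma charpoly_eq_0': "x ^ card G + (\<Sum>i<card G. coeff (charpoly x) i * x ^ i) = 0"
  using charpoly_eq_0[of x]
  by (simp add: coeff_charpoly_top add.commute flip: lessThan_Suc_atMost)

end

text \<open>The parameter \<open>p\<close> is a generator of the maximal ideal of \<open>V\<close>; it is \<open>0\<close> exactly when \<open>V\<close>
  is a field.\<close>

locale galois_valuation = aut_group G for G :: "('k::field \<Rightarrow> 'k) set" +
  fixes V :: "'k set" and p :: 'k
  assumes valuation: "valuation_domain_of V (fixed_field G)"
    and p_in_V: "p \<in> V"
    and p_nonunit: "v \<in> V \<Longrightarrow> p * v \<noteq> 1"
    and nonunit_multiple: "x \<in> V \<Longrightarrow> inverse x \<notin> V \<or> x = 0 \<Longrightarrow> \<exists>v\<in>V. x = p * v"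
begin

section \<open>The extension of \<open>V\<close> to \<open>K\<close> and the description of
  \<open>S\<close> by its conjugates\<close>

abbreviation S :: "'k set" where "S \<equiv> integral_closure V"

lemma subring_V: "subring_of V"
  and V_fixed: "V \<subseteq> fixed_field G"
  and V_valuation: "x \<in> fixed_field G \<Longrightarrow> x \<in> V \<or> inverse x \<in> V"
  using valuation by (auto simp: valuation_domain_of_def subring_of_def)

text \<open>Finitely many elements of a valued field include one of least value, and the quotients
  by it are integral. This serves to rescale a polynomial so that it has coefficients in
  \<open>V\<close> and one coefficient equal to \<open>1\<close>.\<close>

lemma V_dominating_coeff:
  assumes "finite I" "\<And>i. i \<in> I \<Longrightarrow> a i \<in> fixed_field G" "\<exists>i\<in>I. a i \<noteq> 0"
  shows "\<exists>j\<in>I. a j \<noteq> 0 \<and> (\<forall>i\<in>I. a i * inverse (a j) \<in> V)"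
  using assms
proof (induction I rule: finite_induct)
  case (insert k I)
  note V = subring_V
  show ?case
  proof (cases "\<exists>i\<in>I. a i \<noteq> 0")
    case False
    then have "a k \<noteq> 0" "\<forall>i\<in>insert k I. a i * inverse (a k) \<in> V"
      using insert.prems V by (auto intro: subring_closed)
    then show ?thesis by auto
  next
    case True
    then obtain j where j: "j \<in> I" "a j \<noteq> 0" "\<forall>i\<in>I. a i * inverse (a j) \<in> V"
      using insert by auto
    show ?thesis
    proof (cases "a k * inverse (a j) \<in> V")
      case True
      then show ?thesis using j by auto
    next
      case False
      then have k0: "a k \<noteq> 0" using subring_zero[OF V] by auto
      have "a k * inverse (a j) \<in> fixed_field G"
        using insert.prems(1) j(1)
        by (auto intro!: subring_mult subring_fixed_field inverse_fixed_field)
      with False have jk: "a j * inverse (a k) \<in> V"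
        using V_valuation[of "a k * inverse (a j)"] by (simp add: mult.commute)
      have "a i * inverse (a k) \<in> V" if "i \<in> I" for i
      proof -
        have "a i * inverse (a k) = (a i * inverse (a j)) * (a j * inverse (a k))"
          using j(2) by simp
        then show ?thesis using subring_mult[OF V _ jk] j(3) that by metis
      qed
      then show ?thesis using k0 V by (auto intro: subring_one)
    qed
  qed
qed auto

lemma valuation_above_V:
  obtains W where "subring_of W" "V \<subseteq> W" "\<And>w. w \<in> W \<Longrightarrow> p * w \<noteq> 1"
    "\<And>x. x \<in> W \<or> inverse x \<in> W" "S = {x. \<forall>\<sigma>\<in>G. \<sigma> x \<in> W}" "W \<inter> fixed_field G \<subseteq> V"
proof -
  obtain W where W: "subring_of W" "V \<subseteq> W" "\<And>w. w \<in> W \<Longrightarrow> p * w \<noteq> 1"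
    "\<And>x. x \<in> W \<or> inverse x \<in> W"
    using valuation_ring_extension[OF subring_V p_in_V p_nonunit] by metis
  \<comment> \<open>An element of the fixed field outside \<open>V\<close> has its inverse in the
    maximal ideal \<open>p V\<close>; having the element itself in \<open>W\<close> would then make
    \<open>p\<close> a unit of \<open>W\<close>.\<close>
  have WF: "x \<in> V" if x: "x \<in> W" "x \<in> fixed_field G" for x
  proof (rule ccontr)
    assume xV: "x \<notin> V"
    then have "x \<noteq> 0" "inverse x \<in> V" using x V_valuation subring_zero[OF subring_V] by auto
    then obtain v where v: "v \<in> V" "inverse x = p * v"
      using nonunit_multiple[of "inverse x"] xV by auto
    then have "p * (v * x) = 1" using \<open>x \<noteq> 0\<close> by (metis left_inverse mult.assoc)
    then show False using W v x by (meson subring_mult subsetD)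
  qed
  have "S = {x. \<forall>\<sigma>\<in>G. \<sigma> x \<in> W}"
  proof (intro set_eqI iffI)
    fix x assume "x \<in> S"
    then obtain n c where c: "\<forall>i<n. c i \<in> V" "x ^ n + (\<Sum>i<n. c i * x ^ i) = 0"
      unfolding integral_closure_def by blast
    have "\<sigma> x \<in> W" if \<sigma>: "\<sigma> \<in> G" for \<sigma>
    proof (rule valuation_ring_integrally_closed[OF W(1,4)])
      show "\<And>i. i < n \<Longrightarrow> c i \<in> W" using c W by auto
      have "\<sigma> (x ^ n + (\<Sum>i<n. c i * x ^ i)) = \<sigma> x ^ n + (\<Sum>i<n. \<sigma> (c i) * \<sigma> x ^ i)"
        by (simp add: field_aut_simps[OF aut_G[OF \<sigma>]])
      also have "(\<Sum>i<n. \<sigma> (c i) * \<sigma> x ^ i) = (\<Sum>i<n. c i * \<sigma> x ^ i)"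
        using c V_fixed \<sigma> by (intro sum.cong) (auto simp: fixed_fieldD subset_iff)
      finally show "\<sigma> x ^ n + (\<Sum>i<n. c i * \<sigma> x ^ i) = 0"
        using c(2) by (simp add: field_aut_zero[OF aut_G[OF \<sigma>]])
    qed
    then show "x \<in> {x. \<forall>\<sigma>\<in>G. \<sigma> x \<in> W}" by auto
  next
    fix x assume x: "x \<in> {x. \<forall>\<sigma>\<in>G. \<sigma> x \<in> W}"
    \<comment> \<open>The coefficients are polynomial expressions in the conjugates of
      \<open>x\<close>, hence in \<open>W\<close>, and they are fixed by \<open>G\<close>. So the
      characteristic polynomial is an integral equation over \<open>V\<close>.\<close>
    have "coeff (charpoly x) i \<in> V" for i
      using x by (intro WF charpoly_coeff_fixed)
        (auto simp: charpoly_def intro!: coeff_prod_linear_in_subring[OF W(1)])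
    then show "x \<in> S"
      unfolding integral_closure_def using charpoly_eq_0'[of x] by blast
  qed
  then show thesis using that[of W] W WF by blast
qed

text \<open>One extension is chosen once and for all. Any choice serves, since \<open>S\<close> only
  sees the intersection of its conjugates.\<close>

definition W :: "'k set" where
  "W = (SOME W. subring_of W \<and> V \<subseteq> W \<and> (\<forall>w\<in>W. p * w \<noteq> 1) \<and> (\<forall>x. x \<in> W \<or> inverse x \<in> W)
     \<and> S = {x. \<forall>\<sigma>\<in>G. \<sigma> x \<in> W} \<and> W \<inter> fixed_field G \<subseteq> V)"

lemma subring_W: "subring_of W"
  and V_subset_W: "V \<subseteq> W"
  and p_nonunit_W: "w \<in> W \<Longrightarrow> p * w \<noteq> 1"
  and valuation_W: "x \<in> W \<or> inverse x \<in> W"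
  and S_eq: "S = {x. \<forall>\<sigma>\<in>G. \<sigma> x \<in> W}"
  and W_fixed: "W \<inter> fixed_field G \<subseteq> V"
proof -
  have "subring_of W \<and> V \<subseteq> W \<and> (\<forall>w\<in>W. p * w \<noteq> 1) \<and> (\<forall>x. x \<in> W \<or> inverse x \<in> W)
     \<and> S = {x. \<forall>\<sigma>\<in>G. \<sigma> x \<in> W} \<and> W \<inter> fixed_field G \<subseteq> V"
    unfolding W_def by (rule someI_ex, rule valuation_above_V) blast
  then show "subring_of W" "V \<subseteq> W" "w \<in> W \<Longrightarrow> p * w \<noteq> 1" "x \<in> W \<or> inverse x \<in> W"
    "S = {x. \<forall>\<sigma>\<in>G. \<sigma> x \<in> W}" "W \<inter> fixed_field G \<subseteq> V"
    by blast+
qed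

lemma subring_S: "subring_of S"
proof -
  have "subring_of (\<Inter>\<sigma>\<in>G. \<sigma> -` W)"
    by (intro subring_W subring_INT subring_vimage_aut aut_G)
  also have "(\<Inter>\<sigma>\<in>G. \<sigma> -` W) = S" by (auto simp: S_eq)
  finally show ?thesis .
qed

lemma aut_S: "\<sigma> \<in> G \<Longrightarrow> x \<in> S \<Longrightarrow> \<sigma> x \<in> S"
proof -
  assume \<sigma>: "\<sigma> \<in> G" and x: "x \<in> S"
  have "(\<tau> \<circ> \<sigma>) x \<in> W" if "\<tau> \<in> G" for \<tau> using that \<sigma> x S_eq by blast
  then show "\<sigma> x \<in> S" by (simp add: S_eq)
qed

lemma charpoly_coeff_V: "x \<in> S \<Longrightarrow> coeff (charpoly x) i \<in> V"
  using W_fixed subring_W charpoly_coeff_fixed[of x i]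
    coeff_prod_linear_in_subring[of W G "\<lambda>\<sigma>. \<sigma> x" i]
  by (auto simp: charpoly_def S_eq)

lemma V_subset_S: "V \<subseteq> S"
  unfolding S_eq using V_fixed V_subset_W fixed_fieldD by fastforce

text \<open>This places \<open>p\<close> in the Jacobson radical of \<open>S\<close>. In
  \<open>W\<close>, put \<open>u = 1 - p * w\<close>: if \<open>p / u\<close> were outside
  \<open>W\<close>, then \<open>u / p\<close> would be inside and
  \<open>p * (w + u / p) = 1\<close>. So \<open>1 / u = 1 + w * (p / u)\<close> is in
  \<open>W\<close>. Since \<open>p\<close> is fixed by \<open>G\<close>, the same holds for all
  conjugates.\<close>

lemma S_unit: 
  assumes s: "s \<in> S"
  shows "1 - p * s \<noteq> 0" "inverse (1 - p * s) \<in> S"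
proof -
  have Wu: "1 - p * w \<noteq> 0 \<and> inverse (1 - p * w) \<in> W" if w: "w \<in> W" for w
  proof -
    define u where "u = 1 - p * w"
    have u0: "u \<noteq> 0" using p_nonunit_W[OF w] by (auto simp: u_def)
    have "p * inverse u \<in> W"
    proof (rule ccontr)
      assume n: "p * inverse u \<notin> W"
      then have t: "u * inverse p \<in> W" using valuation_W[of "p * inverse u"] by (simp add: mult.commute)
      have "p \<noteq> 0" using n subring_zero[OF subring_W] by (metis mult_zero_left)
      then have "p * (w + u * inverse p) = 1" by (simp add: u_def field_simps)
      then show False using subring_W p_nonunit_W t w subring_add by blast
    qed
    moreover have "inverse u = 1 + w * (p * inverse u)"
    proof -
      have "inverse u = (u + w * p) * inverse u" by (simp add: u_def mult.commute)
      then show ?thesis using u0 by (simp add: distrib_right mult.assoc)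
    qed
    ultimately show ?thesis using u0 w subring_W unfolding u_def
      by (metis subring_add subring_mult subring_one)
  qed
  have \<sigma>s: "\<sigma> s \<in> W" if "\<sigma> \<in> G" for \<sigma> using s that by (simp add: S_eq)
  have \<sigma>p: "\<sigma> p = p" if "\<sigma> \<in> G" for \<sigma> using that p_in_V V_fixed fixed_fieldD by blast
  show "1 - p * s \<noteq> 0" using Wu[of s] \<sigma>s[of id] by simp
  have "\<sigma> (inverse (1 - p * s)) \<in> W" if "\<sigma> \<in> G" for \<sigma>
    using Wu[OF \<sigma>s[OF that]] by (simp add: field_aut_simps[OF aut_G[OF that]] \<sigma>p[OF that])
  then show "inverse (1 - p * s) \<in> S" by (simp add: S_eq)
qed

text \<open>\<open>S\<close> is a Pruefer domain. The witnesses are consecutive truncations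
  \<open>a\<^sub>j + a\<^sub>j\<^sub>+\<^sub>1 x + \<dots> + a\<^sub>n x\<^sup>n\<^sup>-\<^sup>j\<close> of a polynomial relation for \<open>x\<close> over \<open>V\<close> with \<open>a\<^sub>j = 1\<close>.\<close>

lemma pruefer:
  obtains b c where "b \<in> S" "b * x \<in> S" "c \<in> S" "c * x \<in> S" "b - c * x = 1"
proof -
  define n where "n = card G"
  have "\<exists>j\<in>{..n}. coeff (charpoly x) j \<noteq> 0 \<and>
      (\<forall>i\<in>{..n}. coeff (charpoly x) i * inverse (coeff (charpoly x) j) \<in> V)"
  proof (rule V_dominating_coeff[where a = "coeff (charpoly x)" and I = "{..n}"])
    show "\<exists>i\<in>{..n}. coeff (charpoly x) i \<noteq> 0"
      by (rule bexI[of _ n]) (simp_all add: n_def coeff_charpoly_top)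
  qed (simp_all add: charpoly_coeff_fixed)
  then obtain j where j: "j \<le> n" "coeff (charpoly x) j \<noteq> 0"
    "\<And>i. i \<le> n \<Longrightarrow> coeff (charpoly x) i * inverse (coeff (charpoly x) j) \<in> V" by auto
  define a where "a = (\<lambda>i. coeff (charpoly x) i * inverse (coeff (charpoly x) j))"
  have aV: "\<And>i. i \<le> n \<Longrightarrow> a i \<in> V" and aj: "a j = 1" using j by (auto simp: a_def)
  have "(\<Sum>i\<le>n. a i * x ^ i)
      = (\<Sum>i\<le>n. coeff (charpoly x) i * x ^ i) * inverse (coeff (charpoly x) j)"
    unfolding a_def sum_distrib_right by (intro sum.cong refl) (simp only: mult_ac)
  then have a0: "(\<Sum>i\<le>n. a i * x ^ i) = 0" by (simp add: charpoly_eq_0 n_def)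
  define t where "t = (\<lambda>y k. \<Sum>i\<in>{k..n}. a i * y ^ (i - k))"
  have aW: "a i \<in> W" if "i \<le> n" for i using aV[OF that] V_subset_W by (rule subsetD[rotated])
  have tW: "t y k \<in> W \<and> t y k * y \<in> W" if y: "(\<Sum>i\<le>n. a i * y ^ i) = 0" for y k
  proof (cases "y \<in> W")
    case True
    then have "t y k \<in> W"
      unfolding t_def by (intro subring_sum subring_mult subring_power subring_W aW) auto
    then show ?thesis using True subring_W subring_mult by blast
  next
    case False
    then have z: "inverse y \<in> W" and y0: "y \<noteq> 0" using valuation_W subring_zero[OF subring_W] by auto
    \<comment> \<open>The full relation equates \<open>t y k * y ^ k\<close> with minus its terms of
      degree below \<open>k\<close>. Division by \<open>y ^ (k - 1)\<close> leaves a polynomial in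
      the inverse of \<open>y\<close>; for \<open>k = 0\<close> there are no lower terms.\<close>
    have "t y k * y \<in> W"
    proof (cases "k \<le> n")
      case False
      then show ?thesis using subring_W by (simp add: t_def subring_zero)
    next
      case True
      have "{..n} = {..<k} \<union> {k..n}" using True by auto
      then have "(\<Sum>i<k. a i * y ^ i) + (\<Sum>i\<in>{k..n}. a i * y ^ i) = 0"
        using y by (simp add: sum.union_disjoint ivl_disj_int)
      moreover have "(\<Sum>i\<in>{k..n}. a i * y ^ i) = t y k * y ^ k"
        unfolding t_def sum_distrib_right
        by (intro sum.cong) (auto simp: mult.assoc simp flip: power_add)
      ultimately have e: "t y k * y ^ k = - (\<Sum>i<k. a i * y ^ i)"
        by (simp add: eq_neg_iff_add_eq_0 add.commute)
      show ?thesis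
      proof (cases k)
        case 0
        then show ?thesis using e subring_W by (simp add: subring_zero)
      next
        case (Suc l)
        have "t y k * y = t y k * y ^ k * inverse y ^ l"
          using y0 Suc by (simp add: field_simps)
        also have "\<dots> = - (\<Sum>i<k. a i * (y ^ i * inverse y ^ l))"
          unfolding e by (simp add: sum_distrib_right mult.assoc)
        also have "\<dots> = - (\<Sum>i<k. a i * inverse y ^ (l - i))"
          using y0 Suc by (intro arg_cong[of _ _ uminus] sum.cong) (auto simp: power_diff field_simps)
        also have "\<dots> \<in> W"
          using z True
          by (intro subring_uminus subring_sum subring_mult subring_power subring_W aW) auto
        finally show ?thesis .
      qed
    qed
    moreover from this have "t y k * y * inverse y \<in> W" using z subring_W subring_mult by blast
    ultimately show ?thesis using y0 by (simp add: mult.assoc)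
  qed
  have \<sigma>a: "\<sigma> (a i) = a i" if "\<sigma> \<in> G" "i \<le> n" for \<sigma> i
    using aV[OF that(2)] that(1) V_fixed fixed_fieldD by blast
  \<comment> \<open>The \<open>a i\<close> are fixed by \<open>G\<close>, so every conjugate of
    \<open>x\<close> satisfies the same relation and \<open>tW\<close> applies to each of
    them.\<close>
  have tS: "t x k \<in> S" "t x k * x \<in> S" for k
  proof -
    have "\<sigma> (t x k) \<in> W \<and> \<sigma> (t x k * x) \<in> W" if \<sigma>: "\<sigma> \<in> G" for \<sigma>
    proof -
      have "(\<Sum>i\<le>n. a i * \<sigma> x ^ i) = \<sigma> (\<Sum>i\<le>n. a i * x ^ i)"
        using \<sigma>a[OF \<sigma>] by (simp add: field_aut_simps[OF aut_G[OF \<sigma>]])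
      then have "(\<Sum>i\<le>n. a i * \<sigma> x ^ i) = 0" by (simp add: a0 field_aut_zero[OF aut_G[OF \<sigma>]])
      moreover have "\<sigma> (t x k) = t (\<sigma> x) k"
        unfolding t_def using \<sigma>a[OF \<sigma>] by (simp add: field_aut_simps[OF aut_G[OF \<sigma>]])
      ultimately show ?thesis using tW[of "\<sigma> x" k] by (simp add: field_aut_mult[OF aut_G[OF \<sigma>]])
    qed
    then show "t x k \<in> S" "t x k * x \<in> S" by (auto simp: S_eq)
  qed
  \<comment> \<open>The witnesses are \<open>b = t x j\<close> and \<open>c = t x (Suc j)\<close>:
    consecutive truncations differ by the constant term \<open>a j = 1\<close>.\<close>
  have "t x j = a j + (\<Sum>i\<in>{Suc j..n}. a i * x ^ (i - j))"
    unfolding t_def using j(1) by (simp add: sum.atLeast_Suc_atMost)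
  also have "(\<Sum>i\<in>{Suc j..n}. a i * x ^ (i - j)) = t x (Suc j) * x"
    unfolding t_def sum_distrib_right
    by (intro sum.cong) (auto simp: mult.assoc Suc_diff_Suc simp flip: power_Suc2)
  finally have "t x j - t x (Suc j) * x = 1" by (simp add: aj)
  then show thesis using that tS by blast
qed

end

subsection \<open>Ideals of subrings\<close>

lemma ideal_subset: "ideal_in R I \<Longrightarrow> x \<in> I \<Longrightarrow> x \<in> R"
  and ideal_zero: "ideal_in R I \<Longrightarrow> 0 \<in> I"
  and ideal_add: "ideal_in R I \<Longrightarrow> x \<in> I \<Longrightarrow> y \<in> I \<Longrightarrow> x + y \<in> I"
  and ideal_uminus: "ideal_in R I \<Longrightarrow> x \<in> I \<Longrightarrow> - x \<in> I"
  and ideal_mult: "ideal_in R I \<Longrightarrow> r \<in> R \<Longrightarrow> x \<in> I \<Longrightarrow> r * x \<in> I"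
  by (auto simp: ideal_in_def)

lemma ideal_mult_right: "ideal_in R I \<Longrightarrow> r \<in> R \<Longrightarrow> x \<in> I \<Longrightarrow> x * r \<in> I"
  using ideal_mult[of R I r x] by (simp add: mult.commute)

lemma ideal_diff: "ideal_in R I \<Longrightarrow> x \<in> I \<Longrightarrow> y \<in> I \<Longrightarrow> x - y \<in> I"
  by (metis diff_conv_add_uminus ideal_add ideal_uminus)

lemma ideal_sum: "ideal_in R I \<Longrightarrow> (\<And>i. i \<in> A \<Longrightarrow> g i \<in> I) \<Longrightarrow> sum g A \<in> I"
  by (induction A rule: infinite_finite_induct) (auto intro: ideal_zero ideal_add)

lemma ideal_eq_ring: "ideal_in R I \<Longrightarrow> 1 \<in> I \<Longrightarrow> I = R"
proof (rule equalityI)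
  assume I: "ideal_in R I" "1 \<in> I"
  show "I \<subseteq> R" using I by (simp add: ideal_in_def)
  show "R \<subseteq> I"
  proof
    fix r assume "r \<in> R"
    then show "r \<in> I" using ideal_mult[OF I(1) _ I(2), of r] by simp
  qed
qed

lemma ideal_prod_cong_1:
  assumes R: "subring_of R" and I: "ideal_in R I"
    and g: "\<And>i. i \<in> A \<Longrightarrow> g i \<in> R" "\<And>i. i \<in> A \<Longrightarrow> 1 - g i \<in> I"
  shows "1 - prod g A \<in> I"
  using g
proof (induction A rule: infinite_finite_induct)
  case (insert i A)
  have "1 - prod g (insert i A) = (1 - g i) + g i * (1 - prod g A)"
    unfolding prod.insert[OF insert.hyps] by (simp add: algebra_simps)
  moreover have "(1 - g i) + g i * (1 - prod g A) \<in> I"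
    using insert.IH insert.prems by (intro ideal_add[OF I] ideal_mult[OF I]) auto
  ultimately show ?case by metis
qed (use ideal_zero[OF I] in auto)

lemma maximal_ideal: "maximal_ideal_in R M \<Longrightarrow> ideal_in R M"
  by (simp add: maximal_ideal_in_def)

lemma one_notin_maximal: "maximal_ideal_in R M \<Longrightarrow> 1 \<notin> M"
  using ideal_eq_ring[of R M] by (auto simp: maximal_ideal_in_def)

text \<open>The ideal \<open>M + R x\<close> is strictly larger than \<open>M\<close>, hence
  contains \<open>1\<close>.\<close>

lemma maximal_ideal_comaximal:
  assumes R: "subring_of R" and M: "maximal_ideal_in R M" and x: "x \<in> R" "x \<notin> M"
  obtains r where "r \<in> R" "1 - r * x \<in> M"
proof -
  note I = maximal_ideal[OF M]
  define J where "J = {m + r * x | m r. m \<in> M \<and> r \<in> R}"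
  have "ideal_in R J"
    unfolding ideal_in_def
  proof (intro conjI ballI subsetI)
    fix y assume "y \<in> J"
    then obtain m r where y: "y = m + r * x" "m \<in> M" "r \<in> R" unfolding J_def by auto
    then show "y \<in> R" using x ideal_subset[OF I] by (auto intro!: subring_add subring_mult R)
    have "- y = - m + (- r) * x" using y by simp
    then show "- y \<in> J" unfolding J_def using ideal_uminus[OF I] subring_uminus[OF R] y by blast
    fix s assume s: "s \<in> R"
    have "s * y = s * m + (s * r) * x" using y by (simp add: algebra_simps)
    then show "s * y \<in> J" unfolding J_def using ideal_mult[OF I] subring_mult[OF R] y s by blast
  next
    fix y z assume "y \<in> J" "z \<in> J"
    then obtain m r m' r' where y: "y = m + r * x" "m \<in> M" "r \<in> R"
      "z = m' + r' * x" "m' \<in> M" "r' \<in> R" unfolding J_def by blast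
    have "y + z = (m + m') + (r + r') * x" using y by (simp add: algebra_simps)
    then show "y + z \<in> J" unfolding J_def using ideal_add[OF I] subring_add[OF R] y by blast
  next
    have "0 = 0 + 0 * x" by simp
    then show "0 \<in> J" unfolding J_def using ideal_zero[OF I] subring_zero[OF R] by blast
  qed
  moreover have "M \<subseteq> J"
  proof
    fix m assume "m \<in> M"
    moreover have "m = m + 0 * x" by simp
    ultimately show "m \<in> J" unfolding J_def using subring_zero[OF R] by blast
  qed
  moreover have "x \<in> J"
  proof -
    have "x = 0 + 1 * x" by simp
    then show ?thesis unfolding J_def using ideal_zero[OF I] subring_one[OF R] by blast
  qed
  ultimately have "J = R" using M x by (auto simp: maximal_ideal_in_def)
  then obtain m r where "1 = m + r * x" "m \<in> M" "r \<in> R"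
    using subring_one[OF R] unfolding J_def by blast
  moreover from this have "1 - r * x = m" by (simp add: diff_eq_eq)
  ultimately show thesis using that[of r] by simp
qed

lemma maximal_ideal_prime:
  assumes R: "subring_of R" and M: "maximal_ideal_in R M" and xy: "x \<in> R" "y \<in> R" "x * y \<in> M"
  shows "x \<in> M \<or> y \<in> M"
proof (rule disjCI)
  assume "y \<notin> M"
  then obtain r where r: "r \<in> R" "1 - r * y \<in> M"
    using maximal_ideal_comaximal[OF R M xy(2)] by blast
  have "x * (1 - r * y) + r * (x * y) \<in> M"
    using ideal_mult[OF maximal_ideal[OF M] xy(1) r(2)] ideal_mult[OF maximal_ideal[OF M] r(1) xy(3)]
    by (rule ideal_add[OF maximal_ideal[OF M]])
  then show "x \<in> M" by (simp add: algebra_simps)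
qed

lemma maximal_ideal_diff_mult:
  assumes R: "subring_of R" and M: "maximal_ideal_in R M"
    and "x \<in> R - M" "y \<in> R - M"
  shows "x * y \<in> R - M"
  using maximal_ideal_prime[OF R M, of x y] subring_mult[OF R, of x y] assms(3,4) by auto

lemma maximal_ideal_diff_prod:
  assumes R: "subring_of R" and M: "maximal_ideal_in R M"
    and "\<And>i. i \<in> A \<Longrightarrow> g i \<in> R - M"
  shows "prod g A \<in> R - M"
  using assms(3)
proof (induction A rule: infinite_finite_induct)
  case (insert i A)
  then show ?case
    using maximal_ideal_diff_mult[OF R M, of "g i" "prod g A"] by simp
qed (use one_notin_maximal[OF M] subring_one[OF R] in auto)

lemma maximal_ideal_diff_power:
  assumes R: "subring_of R" and M: "maximal_ideal_in R M" and "x \<in> R - M"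
  shows "x ^ n \<in> R - M"
  using maximal_ideal_diff_prod[OF R M, of "{..<n}" "\<lambda>_. x"] assms(3) by (simp add: prod_constant)

lemma maximal_ideal_exists:
  assumes R: "subring_of R" and I: "ideal_in R I" "1 \<notin> I"
  obtains M where "maximal_ideal_in R M" "I \<subseteq> M"
proof -
  define A where "A = {J. ideal_in R J \<and> I \<subseteq> J \<and> 1 \<notin> J}"
  have "\<exists>M\<in>A. \<forall>X\<in>A. M \<subseteq> X \<longrightarrow> X = M"
  proof (rule subset_Zorn_nonempty)
    show "A \<noteq> {}" using I by (auto simp: A_def)
    fix C assume C: "C \<noteq> {}" "subset.chain A C"
    then have CA: "\<And>J. J \<in> C \<Longrightarrow> ideal_in R J \<and> I \<subseteq> J \<and> 1 \<notin> J"
      and ch: "\<And>J K. J \<in> C \<Longrightarrow> K \<in> C \<Longrightarrow> J \<subseteq> K \<or> K \<subseteq> J"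
      by (auto simp: A_def subset_chain_def)
    have "ideal_in R (\<Union>C)"
      unfolding ideal_in_def
    proof (intro conjI ballI)
      show "\<Union>C \<subseteq> R" using CA ideal_subset by blast
      show "0 \<in> \<Union>C" using C(1) CA ideal_zero by blast
      show "- x \<in> \<Union>C" if "x \<in> \<Union>C" for x using that CA ideal_uminus by blast
      show "r * x \<in> \<Union>C" if "r \<in> R" "x \<in> \<Union>C" for r x using that CA ideal_mult by blast
      show "x + y \<in> \<Union>C" if xy: "x \<in> \<Union>C" "y \<in> \<Union>C" for x y
      proof -
        from xy obtain J K where JK: "J \<in> C" "K \<in> C" "x \<in> J" "y \<in> K" by blast
        then obtain L where "L \<in> C" "x \<in> L" "y \<in> L" using ch[of J K] by blast
        then show ?thesis using CA ideal_add by blast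
      qed
    qed
    then show "\<Union>C \<in> A" using C(1) CA by (auto simp: A_def)
  qed
  then obtain M where M: "M \<in> A" and Mmax: "\<And>X. X \<in> A \<Longrightarrow> M \<subseteq> X \<Longrightarrow> X = M" by blast
  have "J = M \<or> J = R" if J: "ideal_in R J" "M \<subseteq> J" for J
  proof (cases "1 \<in> J")
    case True
    then show ?thesis using ideal_eq_ring J by blast
  next
    case False
    then have "J \<in> A" using J M by (auto simp: A_def)
    then show ?thesis using Mmax J by blast
  qed
  moreover have "M \<noteq> R" using M subring_one[OF R] by (auto simp: A_def)
  ultimately show thesis using that[of M] M by (auto simp: A_def maximal_ideal_in_def)
qed

section \<open>The Jacobson radical and squares of ideals\<close>

lemma jacobson_radicalD:
  "x \<in> jacobson_radical R \<Longrightarrow> x \<in> R"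
  "x \<in> jacobson_radical R \<Longrightarrow> maximal_ideal_in R M \<Longrightarrow> x \<in> M"
  by (simp_all add: jacobson_radical_def)

lemma jacobson_radicalI:
  "x \<in> R \<Longrightarrow> (\<And>M. maximal_ideal_in R M \<Longrightarrow> x \<in> M) \<Longrightarrow> x \<in> jacobson_radical R"
  by (simp add: jacobson_radical_def)

lemma ideal_jacobson_radical:
  assumes R: "subring_of R"
  shows "ideal_in R (jacobson_radical R)"
  unfolding ideal_in_def
proof (intro conjI ballI subsetI)
  fix x assume x: "x \<in> jacobson_radical R"
  note xD = jacobson_radicalD[OF x]
  show "x \<in> R" by (rule xD)
  show "- x \<in> jacobson_radical R"
    by (rule jacobson_radicalI[OF subring_uminus[OF R xD(1)]])
      (rule ideal_uminus[OF maximal_ideal xD(2)])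
  show "x + y \<in> jacobson_radical R" if y: "y \<in> jacobson_radical R" for y
    by (rule jacobson_radicalI[OF subring_add[OF R xD(1) jacobson_radicalD(1)[OF y]]])
      (rule ideal_add[OF maximal_ideal xD(2) jacobson_radicalD(2)[OF y]])
  show "r * x \<in> jacobson_radical R" if r: "r \<in> R" for r
    by (rule jacobson_radicalI[OF subring_mult[OF R r xD(1)]])
      (rule ideal_mult[OF maximal_ideal r xD(2)])
next
  show "0 \<in> jacobson_radical R"
    by (rule jacobson_radicalI[OF subring_zero[OF R]]) (rule ideal_zero[OF maximal_ideal])
qed

lemma ideal_sq_mult:
  assumes I: "ideal_in R I" and "r \<in> R" "x \<in> ideal_sq I"
  shows "r * x \<in> ideal_sq I"
proof -
  obtain n :: nat and a b where ab: "\<forall>i<n. a i \<in> I \<and> b i \<in> I" "x = (\<Sum>i<n. a i * b i)"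
    using assms(3) unfolding ideal_sq_def by blast
  have "r * x = (\<Sum>i<n. (r * a i) * b i)" using ab by (simp add: sum_distrib_left mult.assoc)
  moreover have "\<forall>i<n. r * a i \<in> I \<and> b i \<in> I" using ab assms ideal_mult by blast
  ultimately show ?thesis
    unfolding ideal_sq_def
    by (intro CollectI exI[of _ n] exI[of _ "\<lambda>i. r * a i"] exI[of _ b]) simp
qed

lemma ideal_sqI:
  assumes "a \<in> I" "b \<in> I" "c \<in> I" "d \<in> I"
  shows "a * b + c * d \<in> ideal_sq I"
  unfolding ideal_sq_def
proof (intro CollectI exI conjI)
  show "\<forall>i<2. (if i = 0 then a else c) \<in> I \<and> (if i = 0 then b else d) \<in> I" using assms by auto
  show "a * b + c * d = (\<Sum>i<(2::nat). (if i = 0 then a else c) * (if i = 0 then b else d))"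
    by (simp add: numeral_2_eq_2)
qed

lemma ideal_sq_add_mult:
  assumes "x \<in> ideal_sq I" "c \<in> I" "d \<in> I"
  shows "x + c * d \<in> ideal_sq I"
proof -
  obtain n :: nat and a b where ab: "\<forall>i<n. a i \<in> I \<and> b i \<in> I" "x = (\<Sum>i<n. a i * b i)"
    using assms(1) unfolding ideal_sq_def by blast
  have "x + c * d = (\<Sum>i<Suc n. (a(n := c)) i * (b(n := d)) i)" using ab(2) by simp
  moreover have "\<forall>i<Suc n. (a(n := c)) i \<in> I \<and> (b(n := d)) i \<in> I"
    using ab(1) assms(2,3) by (auto simp: less_Suc_eq)
  ultimately show ?thesis
    unfolding ideal_sq_def
    by (intro CollectI exI[of _ "Suc n"] exI[of _ "a(n := c)"] exI[of _ "b(n := d)"] conjI)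
qed

lemma ideal_sq_subset:
  assumes I: "ideal_in R I"
  shows "ideal_sq I \<subseteq> I"
proof
  fix x assume "x \<in> ideal_sq I"
  then obtain n :: nat and a b where ab: "\<forall>i<n. a i \<in> I \<and> b i \<in> I" "x = (\<Sum>i<n. a i * b i)"
    unfolding ideal_sq_def by blast
  show "x \<in> I"
    unfolding ab(2)
  proof (rule ideal_sum[OF I])
    fix i assume "i \<in> {..<n}"
    then show "a i * b i \<in> I" using ab(1) ideal_mult[OF I ideal_subset[OF I]] by blast
  qed
qed

text \<open>The square of a maximal ideal is primary. With \<open>r\<close> an inverse of
  \<open>x\<close> modulo \<open>M\<close>, \<open>y = r * (x * y) + y * (1 - r * x)\<close>, and
  the last term is in the square because primality already gives \<open>y \<in> M\<close>.\<close>

lemma maximal_ideal_sq_cancel: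
  assumes R: "subring_of R" and M: "maximal_ideal_in R M"
    and x: "x \<in> R - M" and y: "y \<in> R" and xy: "x * y \<in> ideal_sq M"
  shows "y \<in> ideal_sq M"
proof -
  have "x * y \<in> M" using ideal_sq_subset[OF maximal_ideal[OF M]] xy by blast
  then have yM: "y \<in> M" using maximal_ideal_prime[OF R M _ y, of x] x by blast
  obtain r where r: "r \<in> R" "1 - r * x \<in> M"
    using maximal_ideal_comaximal[OF R M, of x] x by blast
  have "r * (x * y) + y * (1 - r * x) \<in> ideal_sq M"
    by (rule ideal_sq_add_mult[OF ideal_sq_mult[OF maximal_ideal[OF M] r(1) xy] yM r(2)])
  then show ?thesis by (simp add: algebra_simps)
qed

lemma ideal_sq_image:
  assumes \<sigma>: "is_field_aut \<sigma>" and x: "x \<in> ideal_sq I"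
  shows "\<sigma> x \<in> ideal_sq (\<sigma> ` I)"
proof -
  obtain n :: nat and a b where ab: "\<forall>i<n. a i \<in> I \<and> b i \<in> I" "x = (\<Sum>i<n. a i * b i)"
    using x unfolding ideal_sq_def by blast
  have "\<sigma> x = (\<Sum>i<n. \<sigma> (a i) * \<sigma> (b i))" unfolding ab(2) by (simp add: field_aut_simps[OF \<sigma>])
  then show ?thesis
    unfolding ideal_sq_def using ab(1)
    by (intro CollectI exI[of _ n] exI[of _ "\<lambda>i. \<sigma> (a i)"] exI[of _ "\<lambda>i. \<sigma> (b i)"]) auto
qed

text \<open>Take a nonunit \<open>y\<close> for which the exponent \<open>r\<close> with
  \<open>y ^ r\<close> dividing \<open>p\<close> is greatest. Any nonunit \<open>x\<close> not
  divisible by \<open>y\<close> would factor \<open>y\<close> into two nonunits, and the one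
  dividing the other has a square dividing \<open>y\<close>, so that its power \<open>2 * r\<close>
  divides \<open>p\<close>.\<close>

lemma valuation_ring_uniformizer:
  fixes p :: "'k::field"
  assumes W: "subring_of W" and val: "\<And>x. x \<in> W \<or> inverse x \<in> W"
    and p: "p \<in> W" "p \<noteq> 0" "inverse p \<notin> W"
    and pow: "\<And>x. x \<in> W \<Longrightarrow> x \<noteq> 0 \<Longrightarrow> inverse x \<notin> W \<Longrightarrow> \<exists>w\<in>W. x ^ n = p * w"
  obtains q where "q \<in> W" "q \<noteq> 0" "inverse q \<notin> W"
    "\<And>x. x \<in> W \<Longrightarrow> x \<noteq> 0 \<Longrightarrow> inverse x \<notin> W \<Longrightarrow> x * inverse q \<in> W"
proof -
  define P where "P = (\<lambda>r y. y \<in> W \<and> y \<noteq> 0 \<and> inverse y \<notin> W \<and> (\<exists>w\<in>W. p = y ^ r * w))"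
  have P1: "P 1 p" using p subring_one[OF W] by (auto simp: P_def intro!: bexI[of _ 1])
  \<comment> \<open>If \<open>r > n\<close>, then \<open>p\<close> divides \<open>y ^ n\<close>
    while \<open>y ^ (n + 1)\<close> divides \<open>p\<close>, so \<open>y\<close> would be a
    unit.\<close>
  have bound: "r \<le> n" if Pr: "P r y" for r y
  proof (rule ccontr)
    assume "\<not> r \<le> n"
    then obtain l where l: "r = n + Suc l" using less_iff_Suc_add[of n r] by auto
    obtain w where w: "w \<in> W" "p = y ^ r * w" using Pr by (auto simp: P_def)
    obtain w' where w': "w' \<in> W" "y ^ n = p * w'" using Pr pow[of y] by (auto simp: P_def)
    have "p * 1 = p * (y * (w' * (y ^ l * w)))"
      by (subst w(2)) (simp add: l power_add w'(2) mult_ac)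
    then have "y * (w' * (y ^ l * w)) = 1" using p(2) by simp
    then have "inverse y = w' * (y ^ l * w)" by (rule inverse_unique)
    also have "\<dots> \<in> W" using w w' Pr unfolding P_def by (intro subring_mult subring_power W) auto
    finally show False using Pr by (simp add: P_def)
  qed
  obtain r where r: "\<exists>y. P r y" "\<And>s. \<exists>y. P s y \<Longrightarrow> s \<le> r"
    using Nat.ex_has_greatest_nat[of "\<lambda>r. \<exists>y. P r y" 1 n] P1 bound by blast
  then obtain y where y: "P r y" by blast
  have r1: "1 \<le> r" using r(2)[of 1] P1 by blast
  obtain w where w: "w \<in> W" "p = y ^ r * w" using y by (auto simp: P_def)
  have "x * inverse y \<in> W" if x: "x \<in> W" "x \<noteq> 0" "inverse x \<notin> W" for x
  proof (rule ccontr)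
    assume nxy: "x * inverse y \<notin> W"
    define z where "z = y * inverse x"
    have z: "z \<in> W" "z \<noteq> 0" "inverse z \<notin> W"
      using nxy val[of "x * inverse y"] y x by (auto simp: z_def P_def mult.commute)
    \<comment> \<open>Here \<open>y = x * z\<close>; \<open>t\<close> is whichever of
      \<open>x\<close> and \<open>z\<close> divides the other.\<close>
    obtain t w1 where t: "t \<in> W" "t \<noteq> 0" "inverse t \<notin> W" "w1 \<in> W" "y = t\<^sup>2 * w1"
    proof (cases "x * inverse z \<in> W")
      case True
      have "y = z\<^sup>2 * (x * inverse z)"
        using z x by (simp add: z_def power2_eq_square field_simps)
      then show thesis using that z True by blast
    next
      case False
      then have "z * inverse x \<in> W" using val[of "x * inverse z"] by (simp add: mult.commute)
      moreover have "y = x\<^sup>2 * (z * inverse x)"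
        using x by (simp add: z_def power2_eq_square field_simps)
      ultimately show thesis using that x by blast
    qed
    have "p = t ^ (2 * r) * (w1 ^ r * w)"
      unfolding w(2) t(5) by (simp add: power_mult power_mult_distrib mult.assoc)
    then have "P (2 * r) t"
      unfolding P_def using t w(1) subring_mult[OF W] subring_power[OF W] by blast
    then show False using r(2)[of "2 * r"] r1 by force
  qed
  then show thesis using that[of y] y by (auto simp: P_def)
qed

text \<open>A subring stable under \<open>G\<close> is all that the study of graded ideals asks of
  \<open>S\<close>. Valuations enter again only when the two strands are joined.\<close>

locale aut_ring = aut_group G for G :: "('k::field \<Rightarrow> 'k) set" +
  fixes S :: "'k set"
  assumes S_subring: "subring_of S"
    and S_aut: "\<sigma> \<in> G \<Longrightarrow> x \<in> S \<Longrightarrow> \<sigma> x \<in> S"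
begin

lemma image_inv_image [simp]: "\<sigma> \<in> G \<Longrightarrow> \<sigma> ` inv \<sigma> ` I = I"
  and inv_image_image [simp]: "\<sigma> \<in> G \<Longrightarrow> inv \<sigma> ` \<sigma> ` I = I"
  by (simp_all add: image_comp)

lemma mem_image_iff: "\<sigma> \<in> G \<Longrightarrow> x \<in> \<sigma> ` I \<longleftrightarrow> inv \<sigma> x \<in> I"
proof
  assume "\<sigma> \<in> G" "x \<in> \<sigma> ` I"
  then show "inv \<sigma> x \<in> I" by auto
next
  assume "\<sigma> \<in> G" "inv \<sigma> x \<in> I"
  then show "x \<in> \<sigma> ` I" by (intro image_eqI[of _ _ "inv \<sigma> x"]) simp_all
qed

lemma image_S: "\<sigma> \<in> G \<Longrightarrow> \<sigma> ` S = S"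
proof (rule set_eqI)
  fix x assume "\<sigma> \<in> G"
  then show "x \<in> \<sigma> ` S \<longleftrightarrow> x \<in> S"
    using S_aut[of "inv \<sigma>" x] S_aut[of \<sigma> "inv \<sigma> x"] by (auto simp: mem_image_iff)
qed

lemma ideal_image:
  assumes \<sigma>: "\<sigma> \<in> G" and I: "ideal_in S I"
  shows "ideal_in S (\<sigma> ` I)"
proof -
  note a = field_aut_simps[OF aut_G[OF inv_in_G[OF \<sigma>]]]
  have "x \<in> S" if "inv \<sigma> x \<in> I" for x
    using S_aut[OF \<sigma> ideal_subset[OF I that]] \<sigma> by simp
  then show ?thesis
    unfolding ideal_in_def subset_iff mem_image_iff[OF \<sigma>] Ball_def
    using S_aut[OF inv_in_G[OF \<sigma>]]
    by (simp add: a ideal_zero[OF I] ideal_add[OF I] ideal_uminus[OF I] ideal_mult[OF I])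
qed

lemma maximal_ideal_image:
  assumes \<sigma>: "\<sigma> \<in> G" and M: "maximal_ideal_in S M"
  shows "maximal_ideal_in S (\<sigma> ` M)"
  unfolding maximal_ideal_in_def
proof (intro conjI allI impI)
  show "ideal_in S (\<sigma> ` M)" using ideal_image[OF \<sigma>] M maximal_ideal by blast
  show "\<sigma> ` M \<noteq> S"
    using M image_S[OF inv_in_G[OF \<sigma>]] inv_image_image[OF \<sigma>, of M]
    unfolding maximal_ideal_in_def by metis
  fix J assume J: "ideal_in S J \<and> \<sigma> ` M \<subseteq> J"
  then have "ideal_in S (inv \<sigma> ` J)" "M \<subseteq> inv \<sigma> ` J"
    using ideal_image[of "inv \<sigma>" J] \<sigma> image_mono[of "\<sigma> ` M" J "inv \<sigma>"] by simp_all
  then have "inv \<sigma> ` J = M \<or> inv \<sigma> ` J = S" using M by (auto simp: maximal_ideal_in_def)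
  then show "J = \<sigma> ` M \<or> J = S"
    using image_inv_image[OF \<sigma>, of J] image_S[OF \<sigma>] by metis
qed

text \<open>Automorphisms in \<open>G\<close> permute the maximal ideals of
  \<open>S\<close>.\<close>

lemma aut_jacobson_radical:
  assumes \<sigma>: "\<sigma> \<in> G" and x: "x \<in> jacobson_radical S"
  shows "\<sigma> x \<in> jacobson_radical S"
proof -
  have "\<sigma> x \<in> M" if M: "maximal_ideal_in S M" for M
  proof -
    have "x \<in> inv \<sigma> ` M"
      using x maximal_ideal_image[OF inv_in_G[OF \<sigma>] M] by (auto simp: jacobson_radical_def)
    then show ?thesis using mem_image_iff[of "inv \<sigma>" x M] \<sigma> by simp
  qed
  then show ?thesis using x S_aut[OF \<sigma>] by (auto simp: jacobson_radical_def)
qed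

end

subsection \<open>Maximal ideals of the integral closure\<close>

context galois_valuation
begin

sublocale aut_ring G S
  by unfold_locales (fact subring_S aut_S)+

text \<open>Otherwise some \<open>1 - r * p\<close> would lie in \<open>M\<close>, but these
  elements are units of \<open>S\<close>.\<close>

lemma p_in_maximal:
  assumes M: "maximal_ideal_in S M"
  shows "p \<in> M"
proof (rule ccontr)
  assume "p \<notin> M"
  then obtain r where r: "r \<in> S" "1 - r * p \<in> M"
    using maximal_ideal_comaximal[OF subring_S M] p_in_V V_subset_S by blast
  have "inverse (1 - p * r) * (1 - p * r) \<in> M"
    using r S_unit[OF r(1)] by (intro ideal_mult[OF maximal_ideal[OF M]]) (simp_all add: mult.commute)
  then show False using S_unit[OF r(1)] one_notin_maximal[OF M] by simp
qed

lemma V_maximal_multiple: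
  assumes M: "maximal_ideal_in S M" and v: "v \<in> V" "v \<in> M"
  obtains v' where "v' \<in> V" "v = p * v'"
proof -
  have "inverse v \<notin> V \<or> v = 0"
  proof (rule ccontr)
    assume "\<not> ?thesis"
    then have "inverse v \<in> S" "v \<noteq> 0" using V_subset_S by auto
    moreover from this have "inverse v * v \<in> M" by (intro ideal_mult[OF maximal_ideal[OF M] _ v(2)])
    ultimately show False using one_notin_maximal[OF M] by simp
  qed
  then show thesis using nonunit_multiple[OF v(1)] that by blast
qed

text \<open>Cut the characteristic equation of \<open>x\<close> at the first coefficient
  \<open>c j\<close> outside \<open>M\<close>. The coefficients before it lie in \<open>V\<close>
  and in \<open>M\<close>, hence in \<open>p V\<close>, so the lower part is \<open>p * u\<close>.
  The rest is \<open>s * x ^ j\<close> with \<open>s\<close> congruent to \<open>c j\<close> modulo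
  \<open>M\<close>. Multiplying by \<open>x ^ (n - j)\<close> makes the exponent independent of
  \<open>x\<close>.\<close>

lemma power_multiple_of_p:
  assumes M: "maximal_ideal_in S M" and x: "x \<in> M"
  obtains s u where "s \<in> S - M" "u \<in> S" "s * x ^ card G = p * u"
proof -
  define n where "n = card G"
  define c where "c = coeff (charpoly x)"
  note I = maximal_ideal[OF M]
  have xS: "x \<in> S" by (rule ideal_subset[OF I x])
  have cV: "c i \<in> V" for i unfolding c_def by (rule charpoly_coeff_V[OF xS])
  have cS: "c i \<in> S" for i using cV V_subset_S by blast
  have cn: "c n \<notin> M" using one_notin_maximal[OF M] by (simp add: c_def n_def coeff_charpoly_top)
  \<comment> \<open>Such an index exists because the leading coefficient is
    \<open>1\<close>.\<close>
  define j where "j = (LEAST i. c i \<notin> M)"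
  have cj: "c j \<notin> M" unfolding j_def by (rule LeastI[of _ n]) (rule cn)
  have jn: "j \<le> n" unfolding j_def by (rule Least_le) (rule cn)
  have low: "\<exists>v. v \<in> V \<and> c i = p * v" if "i < j" for i
    using V_maximal_multiple[OF M cV] not_less_Least that unfolding j_def by blast
  then obtain v where v: "\<And>i. i < j \<Longrightarrow> v i \<in> V" "\<And>i. i < j \<Longrightarrow> c i = p * v i" by metis
  define s where "s = (\<Sum>i\<in>{j..n}. c i * x ^ (i - j))"
  define t where "t = (\<Sum>i\<in>{Suc j..n}. c i * x ^ (i - Suc j))"
  define u where "u = (\<Sum>i<j. v i * x ^ i)"
  have tS: "t \<in> S" unfolding t_def
    by (intro subring_sum subring_mult subring_power subring_S cS xS)
  have uS: "u \<in> S" unfolding u_def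
    using v(1) V_subset_S by (intro subring_sum subring_mult subring_power subring_S xS) auto
  have st: "s = c j + t * x"
  proof -
    have "s = c j + (\<Sum>i\<in>{Suc j..n}. c i * x ^ (i - j))"
      unfolding s_def using jn by (simp add: sum.atLeast_Suc_atMost)
    also have "(\<Sum>i\<in>{Suc j..n}. c i * x ^ (i - j)) = t * x"
      unfolding t_def sum_distrib_right
      by (intro sum.cong) (auto simp: mult.assoc Suc_diff_Suc simp flip: power_Suc2)
    finally show ?thesis .
  qed
  have sM: "s \<in> S - M"
  proof -
    have tx: "t * x \<in> M" by (rule ideal_mult[OF I tS x])
    have "s \<notin> M"
    proof
      assume "s \<in> M"
      then have "s - t * x \<in> M" by (rule ideal_diff[OF I _ tx])
      then show False using cj st by simp
    qed
    then show ?thesis using st cS tS xS by (simp add: subring_add subring_mult subring_S)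
  qed
  have "(\<Sum>i\<le>n. c i * x ^ i) = 0" unfolding c_def n_def by (rule charpoly_eq_0)
  moreover have "{..n} = {..<j} \<union> {j..n}" using jn by auto
  ultimately have "(\<Sum>i<j. c i * x ^ i) + (\<Sum>i\<in>{j..n}. c i * x ^ i) = 0"
    by (simp add: sum.union_disjoint ivl_disj_int)
  moreover have "(\<Sum>i\<in>{j..n}. c i * x ^ i) = s * x ^ j"
    unfolding s_def sum_distrib_right
    by (intro sum.cong) (auto simp: mult.assoc simp flip: power_add)
  moreover have "(\<Sum>i<j. c i * x ^ i) = p * u"
    unfolding u_def sum_distrib_left by (intro sum.cong) (auto simp: v(2) mult.assoc)
  ultimately have "s * x ^ j = - (p * u)" by (simp add: eq_neg_iff_add_eq_0 add.commute)
  then have "s * x ^ j * x ^ (n - j) = p * (- u * x ^ (n - j))" by (simp add: mult.assoc)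
  then have "s * x ^ n = p * (- u * x ^ (n - j))"
    using jn by (simp add: mult.assoc flip: power_add)
  moreover have "- u * x ^ (n - j) \<in> S"
    by (intro subring_mult subring_uminus subring_power subring_S uS xS)
  ultimately show thesis using that sM unfolding n_def by blast
qed

section \<open>Localizations of \<open>S\<close> at its maximal ideals, as subrings of
  \<open>K\<close>\<close>

definition loc :: "'k set \<Rightarrow> 'k set" where
  "loc M = {x. \<exists>s\<in>S - M. s * x \<in> S}"

lemma locI: "s \<in> S \<Longrightarrow> s \<notin> M \<Longrightarrow> s * x \<in> S \<Longrightarrow> x \<in> loc M"
  by (auto simp: loc_def)

lemma subring_loc:
  assumes M: "maximal_ideal_in S M"
  shows "subring_of (loc M)"
proof -
  have S_loc: "x \<in> loc M" if "x \<in> S" for x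
    using that one_notin_maximal[OF M] subring_one[OF subring_S] by (intro locI[of 1]) auto
  have "x + y \<in> loc M" "x * y \<in> loc M" if x: "x \<in> loc M" and y: "y \<in> loc M" for x y
  proof -
    obtain s where s: "s \<in> S - M" "s * x \<in> S" using x by (auto simp: loc_def)
    obtain t where t: "t \<in> S - M" "t * y \<in> S" using y by (auto simp: loc_def)
    have st: "s * t \<in> S - M" by (rule maximal_ideal_diff_mult[OF subring_S M s(1) t(1)])
    have "(s * t) * (x + y) = t * (s * x) + s * (t * y)" by (simp add: algebra_simps)
    moreover have "t * (s * x) + s * (t * y) \<in> S"
      using s t by (intro subring_add[OF subring_S] subring_mult[OF subring_S _ s(2)]
          subring_mult[OF subring_S _ t(2)]) auto
    ultimately show "x + y \<in> loc M" using st by (intro locI[of "s * t"]) auto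
    have "(s * t) * (x * y) = (s * x) * (t * y)" by (simp add: algebra_simps)
    moreover have "(s * x) * (t * y) \<in> S" by (rule subring_mult[OF subring_S s(2) t(2)])
    ultimately show "x * y \<in> loc M" using st locI[of "s * t" M "x * y"] by (metis DiffD1 DiffD2)
  qed
  moreover have "- x \<in> loc M" if x: "x \<in> loc M" for x
  proof -
    obtain s where s: "s \<in> S - M" "s * x \<in> S" using x by (auto simp: loc_def)
    then show ?thesis using subring_uminus[OF subring_S s(2)] by (intro locI[of s]) auto
  qed
  moreover have "0 \<in> loc M" "1 \<in> loc M"
    using S_loc subring_zero[OF subring_S] subring_one[OF subring_S] by auto
  ultimately show ?thesis unfolding subring_of_def by blast
qed

text \<open>Use the Pruefer identity \<open>b - c / x = 1\<close> for the inverse of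
  \<open>x\<close>. If \<open>b\<close> or \<open>c\<close> is outside \<open>M\<close>, it is a
  denominator for \<open>1 / x\<close>. If both are in \<open>M\<close>, then \<open>c / x\<close>
  is outside \<open>M\<close>, and it multiplies \<open>x\<close> to \<open>c \<in> M\<close>. In
  particular \<open>loc M\<close> is a valuation ring.\<close>

lemma loc_nonunit:
  assumes M: "maximal_ideal_in S M" and x: "x \<noteq> 0"
  shows "inverse x \<in> loc M \<or> (\<exists>s\<in>S - M. s * x \<in> M)"
proof -
  obtain b c where bc: "b \<in> S" "b * inverse x \<in> S" "c \<in> S" "c * inverse x \<in> S"
    "b - c * inverse x = 1"
    using pruefer[of "inverse x"] by metis
  show ?thesis
  proof (cases "b \<in> M \<and> c \<in> M")
    case False
    then show ?thesis using bc locI by blast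
  next
    case True
    have "c * inverse x \<notin> M"
    proof
      assume "c * inverse x \<in> M"
      then have "b - c * inverse x \<in> M" using True ideal_diff[OF maximal_ideal[OF M]] by blast
      then show False using bc(5) one_notin_maximal[OF M] by simp
    qed
    moreover have "c * inverse x * x = c" using x by (simp add: mult.assoc)
    ultimately show ?thesis using bc(4) True by (metis DiffI)
  qed
qed

lemma inverse_notin_loc:
  assumes M: "maximal_ideal_in S M" and x: "x \<in> M" "x \<noteq> 0"
  shows "inverse x \<notin> loc M"
proof
  assume "inverse x \<in> loc M"
  then obtain s where s: "s \<in> S - M" "s * inverse x \<in> S" by (auto simp: loc_def)
  have "(s * inverse x) * x \<in> M" by (rule ideal_mult[OF maximal_ideal[OF M] s(2) x(1)])
  then show False using s x by (simp add: mult.assoc)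
qed

lemma local_uniformizer:
  assumes p0: "p \<noteq> 0" and M: "maximal_ideal_in S M"
  obtains q where "q \<in> M" "q \<noteq> 0" "\<And>x. x \<in> M \<Longrightarrow> x * inverse q \<in> loc M"
proof -
  note L = subring_loc[OF M]
  have S_loc: "x \<in> loc M" if "x \<in> S" for x
    using that one_notin_maximal[OF M] subring_one[OF subring_S] by (intro locI[of 1]) auto
  have inv_loc: "inverse s \<in> loc M" if "s \<in> S - M" for s
  proof (rule locI[of s])
    have "s \<noteq> 0" using that ideal_zero[OF maximal_ideal[OF M]] by auto
    then show "s * inverse s \<in> S" using subring_one[OF subring_S] by simp
  qed (use that in auto)
  have val: "x \<in> loc M \<or> inverse x \<in> loc M" for x
  proof (cases "x = 0")
    case True
    then show ?thesis using subring_zero[OF L] by simp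
  next
    case False
    then show ?thesis
      using loc_nonunit[OF M False] ideal_subset[OF maximal_ideal[OF M]] by (auto simp: loc_def)
  qed
  have pM: "p \<in> M" by (rule p_in_maximal[OF M])
  have pL: "p \<in> loc M" using S_loc p_in_V V_subset_S by blast
  \<comment> \<open>Multiplying \<open>x\<close> by some \<open>s\<close> outside \<open>M\<close>
    moves it into \<open>M\<close>, where \<open>power_multiple_of_p\<close> applies; the extra
    factor \<open>t * s ^ card G\<close> is a unit of \<open>loc M\<close>.\<close>
  have pow: "\<exists>w\<in>loc M. x ^ card G = p * w" if x: "x \<noteq> 0" "inverse x \<notin> loc M" for x
  proof -
    obtain s where s: "s \<in> S - M" "s * x \<in> M" using loc_nonunit[OF M x(1)] x(2) by blast
    obtain t u where tu: "t \<in> S - M" "u \<in> S" "t * (s * x) ^ card G = p * u"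
      using power_multiple_of_p[OF M s(2)] by blast
    have ts: "t * s ^ card G \<in> S - M"
      using maximal_ideal_diff_mult[OF subring_S M tu(1) maximal_ideal_diff_power[OF subring_S M s(1)]] .
    then have ts0: "t * s ^ card G \<noteq> 0" using ideal_zero[OF maximal_ideal[OF M]] by (metis DiffD2)
    have "x ^ card G = p * (u * inverse (t * s ^ card G))"
      using tu(3) ts0 by (simp add: power_mult_distrib field_simps)
    moreover have "u * inverse (t * s ^ card G) \<in> loc M"
      by (rule subring_mult[OF L S_loc[OF tu(2)] inv_loc[OF ts]])
    ultimately show ?thesis by blast
  qed
  obtain q where q: "q \<in> loc M" "q \<noteq> 0" "inverse q \<notin> loc M"
    "\<And>x. x \<in> loc M \<Longrightarrow> x \<noteq> 0 \<Longrightarrow> inverse x \<notin> loc M \<Longrightarrow> x * inverse q \<in> loc M"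
    using valuation_ring_uniformizer[OF L val pL p0 inverse_notin_loc[OF M pM p0] pow] by blast
  \<comment> \<open>The uniformizer \<open>q\<close> of \<open>loc M\<close> need not be in
    \<open>S\<close>; multiplication by the local unit \<open>s\<close> brings it into
    \<open>M\<close>.\<close>
  obtain s where s: "s \<in> S - M" "s * q \<in> M" using loc_nonunit[OF M q(2)] q(3) by blast
  have s0: "s \<noteq> 0" using s ideal_zero[OF maximal_ideal[OF M]] by auto
  have "x * inverse (s * q) \<in> loc M" if x: "x \<in> M" for x
  proof (cases "x = 0")
    case True
    then show ?thesis using subring_zero[OF L] by simp
  next
    case False
    have "x * inverse q \<in> loc M"
      by (rule q(4)[OF S_loc[OF ideal_subset[OF maximal_ideal[OF M] x]] False
            inverse_notin_loc[OF M x False]])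
    then have "x * inverse q * inverse s \<in> loc M" by (rule subring_mult[OF L _ inv_loc[OF s(1)]])
    then show ?thesis by (simp add: mult_ac)
  qed
  then show thesis using that[of "s * q"] s(2) s0 q(2) by simp
qed

text \<open>If \<open>N\<close> were no conjugate of \<open>M\<close>, some \<open>b\<close> in all
  conjugates of \<open>M\<close> would be congruent to \<open>1\<close> modulo \<open>N\<close>. The
  norm \<open>z\<close> of \<open>1 - b\<close> lies in \<open>V\<close> and in \<open>N\<close>,
  hence in \<open>p V\<close> and so in \<open>M\<close>. Yet all conjugates of \<open>b\<close> lie
  in \<open>M\<close>, which makes \<open>z\<close> congruent to \<open>1\<close> modulo
  \<open>M\<close>.\<close>

lemma maximal_ideals_conjugate:
  assumes M: "maximal_ideal_in S M" and N: "maximal_ideal_in S N"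
  shows "\<exists>\<sigma>\<in>G. N = \<sigma> ` M"
proof (rule ccontr)
  assume no: "\<not> ?thesis"
  have "\<exists>a. a \<in> \<sigma> ` M \<and> 1 - a \<in> N" if \<sigma>: "\<sigma> \<in> G" for \<sigma>
  proof -
    note \<sigma>M = maximal_ideal_image[OF \<sigma> M]
    have "\<not> \<sigma> ` M \<subseteq> N"
    proof
      assume "\<sigma> ` M \<subseteq> N"
      then have "N = \<sigma> ` M \<or> N = S" using \<sigma>M maximal_ideal[OF N] by (auto simp: maximal_ideal_in_def)
      then show False using no \<sigma> N by (auto simp: maximal_ideal_in_def)
    qed
    then obtain x where x: "x \<in> \<sigma> ` M" "x \<notin> N" by blast
    have xS: "x \<in> S" by (rule ideal_subset[OF maximal_ideal[OF \<sigma>M] x(1)])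
    obtain r where r: "r \<in> S" "1 - r * x \<in> N" using maximal_ideal_comaximal[OF subring_S N xS x(2)] .
    moreover have "r * x \<in> \<sigma> ` M" by (rule ideal_mult[OF maximal_ideal[OF \<sigma>M] r(1) x(1)])
    ultimately show ?thesis by blast
  qed
  then obtain a where a: "\<And>\<sigma>. \<sigma> \<in> G \<Longrightarrow> a \<sigma> \<in> \<sigma> ` M" "\<And>\<sigma>. \<sigma> \<in> G \<Longrightarrow> 1 - a \<sigma> \<in> N" by metis
  have aS: "a \<sigma> \<in> S" if "\<sigma> \<in> G" for \<sigma>
    by (rule ideal_subset[OF maximal_ideal[OF maximal_ideal_image[OF that M]] a(1)[OF that]])
  define b where "b = prod a G"
  have bN: "1 - b \<in> N" unfolding b_def
    by (rule ideal_prod_cong_1[OF subring_S maximal_ideal[OF N] aS a(2)])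
  have bS: "b \<in> S" unfolding b_def by (rule subring_prod[OF subring_S aS])
  have bM: "b \<in> \<sigma> ` M" if \<sigma>: "\<sigma> \<in> G" for \<sigma>
  proof -
    have "b = (\<Prod>\<tau>\<in>G - {\<sigma>}. a \<tau>) * a \<sigma>"
      unfolding b_def using \<sigma> finite_G by (simp add: prod.remove[of G \<sigma>] mult.commute)
    also have "\<dots> \<in> \<sigma> ` M"
      by (rule ideal_mult[OF maximal_ideal[OF maximal_ideal_image[OF \<sigma> M]] _ a(1)[OF \<sigma>]])
        (rule subring_prod[OF subring_S], rule aS, simp)
    finally show ?thesis .
  qed
  define z where "z = (\<Prod>\<sigma>\<in>G. \<sigma> (1 - b))"
  have \<sigma>S: "\<sigma> (1 - b) \<in> S" if "\<sigma> \<in> G" for \<sigma>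
    by (rule aut_S[OF that subring_diff[OF subring_S subring_one[OF subring_S] bS]])
  have zS: "z \<in> S" unfolding z_def by (rule subring_prod[OF subring_S \<sigma>S])
  have "\<tau> z = z" if \<tau>: "\<tau> \<in> G" for \<tau>
  proof -
    have "\<tau> z = (\<Prod>\<sigma>\<in>G. (\<tau> \<circ> \<sigma>) (1 - b))"
      unfolding z_def field_aut_prod[OF aut_G[OF \<tau>]] by simp
    also have "\<dots> = z" unfolding z_def by (rule prod.reindex_bij_betw[OF comp_bij_betw[OF \<tau>]])
    finally show ?thesis .
  qed
  then have "z \<in> fixed_field G" by (simp add: fixed_field_def)
  moreover have "id z \<in> W" using zS id_in_G unfolding S_eq by blast
  ultimately have zV: "z \<in> V" using W_fixed by auto
  have "z = (\<Prod>\<sigma>\<in>G - {id}. \<sigma> (1 - b)) * (1 - b)"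
    unfolding z_def using finite_G by (simp add: prod.remove[of G id] mult.commute)
  also have "\<dots> \<in> N"
    by (rule ideal_mult[OF maximal_ideal[OF N] _ bN]) (rule subring_prod[OF subring_S], rule \<sigma>S, simp)
  finally have zN: "z \<in> N" .
  obtain v where v: "v \<in> V" "z = p * v" by (rule V_maximal_multiple[OF N zV zN])
  have "v * p \<in> M"
    using v(1) V_subset_S by (intro ideal_mult[OF maximal_ideal[OF M]] p_in_maximal[OF M]) auto
  then have zM: "z \<in> M" by (simp add: v(2) mult.commute)
  have "1 - z \<in> M" unfolding z_def
  proof (rule ideal_prod_cong_1[OF subring_S maximal_ideal[OF M] \<sigma>S])
    fix \<sigma> assume \<sigma>: "\<sigma> \<in> G"
    have "\<sigma> b \<in> M" using bM[OF inv_in_G[OF \<sigma>]] \<sigma> mem_image_iff[of "inv \<sigma>" b M] by simp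
    then show "1 - \<sigma> (1 - b) \<in> M" by (simp add: field_aut_simps[OF aut_G[OF \<sigma>]])
  qed
  then have "(1 - z) + z \<in> M" using zM by (rule ideal_add[OF maximal_ideal[OF M]])
  then show False using one_notin_maximal[OF M] by simp
qed

text \<open>Conjugacy leaves only finitely many maximal ideals. The product of elements chosen in
  each \<open>N\<close> outside \<open>M\<close> works, since \<open>M\<close> is prime.\<close>

lemma maximal_ideal_separator:
  assumes M: "maximal_ideal_in S M"
  obtains e where "e \<in> S - M" "\<And>N. maximal_ideal_in S N \<Longrightarrow> N \<noteq> M \<Longrightarrow> e \<in> N"
proof -
  define X where "X = {N. maximal_ideal_in S N \<and> N \<noteq> M}"
  have "X \<subseteq> (\<lambda>\<sigma>. \<sigma> ` M) ` G" using maximal_ideals_conjugate[OF M] by (auto simp: X_def)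
  then have fin: "finite X" using finite_G by (rule finite_subset[OF _ finite_imageI])
  have "\<exists>x. x \<in> N \<and> x \<notin> M" if "N \<in> X" for N
  proof (rule ccontr)
    assume "\<not> ?thesis"
    then have "N \<subseteq> M" by blast
    then have "M = N \<or> M = S" using that maximal_ideal[OF M] by (auto simp: X_def maximal_ideal_in_def)
    then show False using that M by (auto simp: X_def maximal_ideal_in_def)
  qed
  then obtain x where x: "\<And>N. N \<in> X \<Longrightarrow> x N \<in> N" "\<And>N. N \<in> X \<Longrightarrow> x N \<notin> M" by metis
  have xS: "x N \<in> S" if "N \<in> X" for N
    using that x(1)[OF that] ideal_subset[OF maximal_ideal, of S N] by (auto simp: X_def)
  have "prod x X \<in> S - M"
    by (rule maximal_ideal_diff_prod[OF subring_S M]) (simp add: xS x(2))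
  moreover have "prod x X \<in> N" if N: "maximal_ideal_in S N" "N \<noteq> M" for N
  proof -
    have NX: "N \<in> X" using N by (simp add: X_def)
    have "prod x X = prod x (X - {N}) * x N"
      using NX fin by (simp add: prod.remove[of X N] mult.commute)
    also have "\<dots> \<in> N"
      by (rule ideal_mult[OF maximal_ideal[OF N(1)] _ x(1)[OF NX]])
        (rule subring_prod[OF subring_S], rule xS, simp)
    finally show ?thesis .
  qed
  ultimately show thesis using that by blast
qed

text \<open>The denominators of \<open>x\<close> form an ideal \<open>D\<close>; a proper
  \<open>D\<close> would lie in some maximal ideal, against membership of \<open>x\<close> in that
  localization.\<close>

lemma S_local:
  assumes "\<And>M. maximal_ideal_in S M \<Longrightarrow> x \<in> loc M"
  shows "x \<in> S"
proof (rule ccontr)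
  assume x: "x \<notin> S"
  define D where "D = {s \<in> S. s * x \<in> S}"
  have "ideal_in S D"
    unfolding ideal_in_def D_def
    using subring_zero[OF subring_S] subring_add[OF subring_S] subring_uminus[OF subring_S]
      subring_mult[OF subring_S]
    by (auto simp: distrib_right mult.assoc)
  moreover have "1 \<notin> D" using x by (simp add: D_def)
  ultimately obtain M where M: "maximal_ideal_in S M" "D \<subseteq> M"
    using maximal_ideal_exists[OF subring_S] by blast
  then show False using assms[OF M(1)] by (auto simp: loc_def D_def)
qed

text \<open>Invertibility of \<open>M\<close> is expressed by an element \<open>k\<close> of the
  inverse ideal with \<open>k M\<close> not contained in \<open>M\<close>, in the form of an
  explicit decomposition of \<open>1\<close>. The idea is to take \<open>1 / q\<close> for a local
  uniformizer \<open>q\<close> and to cancel its poles at the other maximal ideals.\<close>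

lemma maximal_ideal_invertible:
  assumes p0: "p \<noteq> 0" and M: "maximal_ideal_in S M"
  obtains k m m' where "\<And>y. y \<in> M \<Longrightarrow> k * y \<in> S" "m \<in> M" "m' \<in> M" "k * m + m' = 1"
proof -
  note I = maximal_ideal[OF M]
  obtain q where q: "q \<in> M" "q \<noteq> 0" "\<And>x. x \<in> M \<Longrightarrow> x * inverse q \<in> loc M"
    using local_uniformizer[OF p0 M] by blast
  obtain e where e: "e \<in> S - M" "\<And>N. maximal_ideal_in S N \<Longrightarrow> N \<noteq> M \<Longrightarrow> e \<in> N"
    using maximal_ideal_separator[OF M] by blast
  obtain s where s: "s \<in> S - M" "s * (p * inverse q) \<in> S"
    using q(3)[OF p_in_maximal[OF M]] by (auto simp: loc_def)
  define n where "n = card G"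
  \<comment> \<open>At \<open>M\<close> the factor \<open>e ^ n * s\<close> is a unit and
    \<open>1 / q\<close> maps \<open>M\<close> into \<open>loc M\<close>. At any other maximal ideal
    \<open>e ^ n\<close> is locally a multiple of \<open>p\<close>, and \<open>s * p / q\<close> is
    already in \<open>S\<close>.\<close>
  define k where "k = e ^ n * s * inverse q"
  have es: "e ^ n * s \<in> S - M"
    by (rule maximal_ideal_diff_mult[OF subring_S M maximal_ideal_diff_power[OF subring_S M e(1)] s(1)])
  have kM: "k * y \<in> S" if y: "y \<in> M" for y
  proof (rule S_local)
    fix N assume N: "maximal_ideal_in S N"
    show "k * y \<in> loc N"
    proof (cases "N = M")
      case True
      obtain t where t: "t \<in> S - M" "t * (y * inverse q) \<in> S" using q(3)[OF y] by (auto simp: loc_def)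
      have "t * (k * y) = (e ^ n * s) * (t * (y * inverse q))" by (simp add: k_def mult_ac)
      also have "\<dots> \<in> S" using es by (intro subring_mult[OF subring_S _ t(2)]) auto
      finally show ?thesis using t True by (intro locI[of t]) auto
    next
      case False
      obtain t u where tu: "t \<in> S - N" "u \<in> S" "t * e ^ n = p * u"
        using power_multiple_of_p[OF N e(2)[OF N False]] unfolding n_def .
      have "t * (k * y) = (t * e ^ n) * s * inverse q * y" by (simp add: k_def mult_ac)
      also have "\<dots> = u * (s * (p * inverse q)) * y" unfolding tu(3) by (simp add: mult_ac)
      also have "\<dots> \<in> S"
        by (rule subring_mult[OF subring_S subring_mult[OF subring_S tu(2) s(2)] ideal_subset[OF I y]])
      finally show ?thesis using tu by (intro locI[of t]) auto
    qed
  qed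
  have kq: "k * q = e ^ n * s" using q(2) by (simp add: k_def)
  \<comment> \<open>Since \<open>k * q = e ^ n * s\<close> is outside \<open>M\<close>, it is
    invertible modulo \<open>M\<close>.\<close>
  obtain r where r: "r \<in> S" "1 - r * (k * q) \<in> M"
    using maximal_ideal_comaximal[OF subring_S M, of "k * q"] es kq by auto
  show thesis
  proof (rule that[OF kM])
    show "r * q \<in> M" by (rule ideal_mult[OF I r(1) q(1)])
    show "1 - r * (k * q) \<in> M" by (rule r(2))
    show "k * (r * q) + (1 - r * (k * q)) = 1" by (simp add: mult_ac)
  qed
qed

text \<open>At a maximal ideal \<open>M\<close> containing \<open>g\<close>, take \<open>k\<close>
  from invertibility. If \<open>k * g\<close> were in \<open>M\<close>, then
  \<open>g = (k * g) * m + g * m'\<close> would lie in the square of \<open>M\<close>. So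
  \<open>k * g\<close> is a legitimate denominator for \<open>a / g\<close>, with numerator
  \<open>k * a\<close> in \<open>S\<close>.\<close>

lemma jacobson_radical_multiple:
  assumes p0: "p \<noteq> 0" and g: "g \<in> S" "g \<noteq> 0" "\<And>M. maximal_ideal_in S M \<Longrightarrow> g \<notin> ideal_sq M"
    and a: "a \<in> jacobson_radical S"
  shows "a * inverse g \<in> S"
proof (rule S_local)
  fix M assume M: "maximal_ideal_in S M"
  note I = maximal_ideal[OF M]
  show "a * inverse g \<in> loc M"
  proof (cases "g \<in> M")
    case False
    have "g * (a * inverse g) = a" using g(2) by (simp add: field_simps)
    then have "g * (a * inverse g) \<in> S" using jacobson_radicalD(1)[OF a] by metis
    then show ?thesis by (rule locI[OF g(1) False])
  next
    case True
    obtain k m m' where k: "\<And>y. y \<in> M \<Longrightarrow> k * y \<in> S" "m \<in> M" "m' \<in> M" "k * m + m' = 1"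
      using maximal_ideal_invertible[OF p0 M] by blast
    have "k * g \<notin> M"
    proof
      assume kg: "k * g \<in> M"
      have "g = (k * m + m') * g" using k(4) by simp
      also have "\<dots> = (k * g) * m + g * m'" by (simp add: algebra_simps)
      also have "\<dots> \<in> ideal_sq M" by (rule ideal_sqI[OF kg k(2) True k(3)])
      finally show False using g(3)[OF M] by simp
    qed
    moreover have "k * g * (a * inverse g) = k * a" using g(2) by (simp add: field_simps)
    ultimately show ?thesis
      using k(1)[OF True] k(1)[OF jacobson_radicalD(2)[OF a M]] locI[of "k * g"] by metis
  qed
qed

text \<open>For \<open>e\<close> outside \<open>M\<close> but in all other maximal ideals,
  \<open>e M\<close> lies in the Jacobson radical, so \<open>k * e\<close> maps \<open>M\<close>
  into \<open>M\<close>. Multiplying \<open>e * k\<close> by \<open>1 = l * m + m'\<close> then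
  shows that \<open>e * k\<close> is in \<open>S\<close>.\<close>

lemma jacobson_radical_multiplier:
  assumes p0: "p \<noteq> 0" and k: "\<And>a. a \<in> jacobson_radical S \<Longrightarrow> k * a \<in> jacobson_radical S"
  shows "k \<in> S"
proof (rule S_local)
  fix M assume M: "maximal_ideal_in S M"
  note I = maximal_ideal[OF M]
  obtain e where e: "e \<in> S - M" "\<And>N. maximal_ideal_in S N \<Longrightarrow> N \<noteq> M \<Longrightarrow> e \<in> N"
    using maximal_ideal_separator[OF M] by blast
  obtain l m m' where l: "\<And>y. y \<in> M \<Longrightarrow> l * y \<in> S" "m \<in> M" "m' \<in> M" "l * m + m' = 1"
    using maximal_ideal_invertible[OF p0 M] by blast
  have key: "k * (e * y) \<in> M" if y: "y \<in> M" for y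
  proof -
    have yS: "y \<in> S" by (rule ideal_subset[OF I y])
    have "e * y \<in> jacobson_radical S"
    proof (rule jacobson_radicalI)
      show "e * y \<in> S" using e(1) yS by (simp add: subring_mult[OF subring_S])
      fix N assume N: "maximal_ideal_in S N"
      show "e * y \<in> N"
      proof (cases "N = M")
        case True
        then show ?thesis using e(1) y ideal_mult[OF I] by simp
      next
        case False
        then show ?thesis by (intro ideal_mult_right[OF maximal_ideal[OF N] yS] e(2) N)
      qed
    qed
    then show ?thesis using jacobson_radicalD(2)[OF k M] by blast
  qed
  have "e * k = (l * m + m') * (e * k)" using l(4) by simp
  also have "\<dots> = l * (k * (e * m)) + k * (e * m')" by (simp add: algebra_simps)
  also have "\<dots> \<in> S"
    by (intro subring_add[OF subring_S] l(1) key l(2) ideal_subset[OF I] l(3))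
  finally show "k \<in> loc M" using e(1) by (intro locI[of e]) auto
qed

end

subsection \<open>Graded left ideals of the crossed product order\<close>

text \<open>The homogeneous element \<open>s x_\<sigma>\<close>.\<close>

definition single :: "'k::field \<Rightarrow> ('k \<Rightarrow> 'k) \<Rightarrow> ('k \<Rightarrow> 'k) \<Rightarrow> 'k" where
  "single s \<sigma> = (\<lambda>\<rho>. if \<rho> = \<sigma> then s else 0)"

lemma cp_component_single: "cp_component a \<sigma> = single (a \<sigma>) \<sigma>"
  by (simp add: cp_component_def single_def)

section \<open>The cocycle and products with homogeneous elements\<close>

locale crossed_product_order = aut_ring G S for G :: "('k::field \<Rightarrow> 'k) set" and S +
  fixes f :: "('k \<Rightarrow> 'k) \<Rightarrow> ('k \<Rightarrow> 'k) \<Rightarrow> 'k"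
  assumes cocycle: "normalized_cocycle G S f"
begin

lemma f_in_S [simp]: "\<sigma> \<in> G \<Longrightarrow> \<tau> \<in> G \<Longrightarrow> f \<sigma> \<tau> \<in> S"
  and f_nonzero: "\<sigma> \<in> G \<Longrightarrow> \<tau> \<in> G \<Longrightarrow> f \<sigma> \<tau> \<noteq> 0"
  and f_cocycle: "\<sigma> \<in> G \<Longrightarrow> \<tau> \<in> G \<Longrightarrow> \<gamma> \<in> G \<Longrightarrow>
    \<sigma> (f \<tau> \<gamma>) * f \<sigma> (\<tau> \<circ> \<gamma>) = f \<sigma> \<tau> * f (\<sigma> \<circ> \<tau>) \<gamma>"
  and f_id_left [simp]: "\<sigma> \<in> G \<Longrightarrow> f id \<sigma> = 1"
  and f_id_right [simp]: "\<sigma> \<in> G \<Longrightarrow> f \<sigma> id = 1"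
  using cocycle by (simp_all add: normalized_cocycle_def)

text \<open>This and the next two identities specialise the cocycle condition so that some composite
  collapses: to \<open>id\<close>, where \<open>f\<close> is \<open>1\<close>, or to
  \<open>inv \<sigma>\<close> in \<open>f_comp_inv\<close>.\<close>

lemma f_inv_swap: "\<sigma> \<in> G \<Longrightarrow> \<sigma> (f (inv \<sigma>) \<sigma>) = f \<sigma> (inv \<sigma>)"
  using f_cocycle[of \<sigma> "inv \<sigma>" \<sigma>] by simp

lemma f_inv_factor:
  "\<sigma> \<in> G \<Longrightarrow> \<tau> \<in> G \<Longrightarrow> \<sigma> (f \<tau> (inv \<tau>)) = f \<sigma> \<tau> * f (\<sigma> \<circ> \<tau>) (inv \<tau>)"
  using f_cocycle[of \<sigma> \<tau> "inv \<tau>"] by simp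

lemma f_comp_inv:
  assumes "\<sigma> \<in> G" "\<tau> \<in> G"
  shows "\<sigma> (f \<tau> (inv (\<sigma> \<circ> \<tau>))) * f \<sigma> (inv \<sigma>) = f \<sigma> \<tau> * f (\<sigma> \<circ> \<tau>) (inv (\<sigma> \<circ> \<tau>))"
  using f_cocycle[of \<sigma> \<tau> "inv (\<sigma> \<circ> \<tau>)"] assms by (simp add: inv_comp_distrib)

lemma cp_mult_single_left:
  assumes "\<sigma> \<in> G" "\<rho> \<in> G"
  shows "cp_mult G f (single s \<sigma>) b \<rho> = s * \<sigma> (b (inv \<sigma> \<circ> \<rho>)) * f \<sigma> (inv \<sigma> \<circ> \<rho>)"
proof -
  have "cp_mult G f (single s \<sigma>) b \<rho>
      = (\<Sum>\<tau>\<in>G. if \<tau> = \<sigma> then s * \<sigma> (b (inv \<sigma> \<circ> \<rho>)) * f \<sigma> (inv \<sigma> \<circ> \<rho>) else 0)"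
    unfolding cp_mult_def single_def using assms by (auto intro: sum.cong)
  then show ?thesis using assms finite_G by simp
qed

lemma cp_mult_single_right:
  assumes "\<tau> \<in> G" "\<rho> \<in> G"
  shows "cp_mult G f a (single t \<tau>) \<rho> = a (\<rho> \<circ> inv \<tau>) * (\<rho> \<circ> inv \<tau>) t * f (\<rho> \<circ> inv \<tau>) \<tau>"
proof -
  have iff: "inv \<sigma> \<circ> \<rho> = \<tau> \<longleftrightarrow> \<sigma> = \<rho> \<circ> inv \<tau>" if \<sigma>: "\<sigma> \<in> G" for \<sigma>
  proof
    assume "inv \<sigma> \<circ> \<rho> = \<tau>"
    then have "\<rho> = \<sigma> \<circ> \<tau>" using comp_inv_cancel[OF \<sigma>, of \<rho>] by simp
    then show "\<sigma> = \<rho> \<circ> inv \<tau>" using assms by (simp add: comp_assoc)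
  next
    assume eq: "\<sigma> = \<rho> \<circ> inv \<tau>"
    show "inv \<sigma> \<circ> \<rho> = \<tau>" unfolding eq using assms by (simp add: inv_comp_distrib comp_assoc)
  qed
  have "cp_mult G f a (single t \<tau>) \<rho>
      = (\<Sum>\<sigma>\<in>G. if \<sigma> = \<rho> \<circ> inv \<tau> then a (\<rho> \<circ> inv \<tau>) * (\<rho> \<circ> inv \<tau>) t * f (\<rho> \<circ> inv \<tau>) \<tau> else 0)"
    unfolding cp_mult_def if_P[OF assms(2)]
  proof (rule sum.cong[OF refl])
    fix \<sigma> assume \<sigma>: "\<sigma> \<in> G"
    show "a \<sigma> * \<sigma> (single t \<tau> (inv \<sigma> \<circ> \<rho>)) * f \<sigma> (inv \<sigma> \<circ> \<rho>)
      = (if \<sigma> = \<rho> \<circ> inv \<tau> then a (\<rho> \<circ> inv \<tau>) * (\<rho> \<circ> inv \<tau>) t * f (\<rho> \<circ> inv \<tau>) \<tau> else 0)"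
    proof (cases "\<sigma> = \<rho> \<circ> inv \<tau>")
      case True
      then have "inv \<sigma> \<circ> \<rho> = \<tau>" using iff[OF \<sigma>] by blast
      then show ?thesis using True by (simp add: single_def)
    next
      case False
      then have "inv \<sigma> \<circ> \<rho> \<noteq> \<tau>" using iff[OF \<sigma>] by blast
      then show ?thesis using False by (simp add: single_def field_aut_zero[OF aut_G[OF \<sigma>]])
    qed
  qed
  then show ?thesis using assms finite_G by simp
qed

lemma cp_mult_outside: "\<rho> \<notin> G \<Longrightarrow> cp_mult G f a b \<rho> = 0"
  by (simp add: cp_mult_def)

lemma cp_mult_one: "a \<in> cp_order G S \<Longrightarrow> cp_mult G f a (single 1 id) = a"
proof (rule ext)
  fix \<rho> assume a: "a \<in> cp_order G S"
  show "cp_mult G f a (single 1 id) \<rho> = a \<rho>"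
  proof (cases "\<rho> \<in> G")
    case True
    then show ?thesis
      using cp_mult_single_right[OF id_in_G True] by (simp add: inv_id field_aut_one[OF aut_G[OF True]])
  next
    case False
    then show ?thesis using a by (simp add: cp_mult_outside cp_order_def cp_carrier_def)
  qed
qed

lemma cp_mult_single_id: "cp_mult G f (single r id) (single s id) = single (r * s) id"
proof (rule ext)
  fix \<rho>
  show "cp_mult G f (single r id) (single s id) \<rho> = single (r * s) id \<rho>"
  proof (cases "\<rho> \<in> G")
    case True
    then show ?thesis using cp_mult_single_left[OF id_in_G True] by (simp add: inv_id single_def)
  next
    case False
    then show ?thesis using id_in_G by (auto simp: cp_mult_outside single_def)
  qed
qed

lemma cp_mult_single_inv:
  assumes \<sigma>: "\<sigma> \<in> G"
  shows "cp_mult G f (single 1 (inv \<sigma>)) (single s \<sigma>) = single (inv \<sigma> s * f (inv \<sigma>) \<sigma>) id"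
proof (rule ext)
  fix \<rho>
  show "cp_mult G f (single 1 (inv \<sigma>)) (single s \<sigma>) \<rho> = single (inv \<sigma> s * f (inv \<sigma>) \<sigma>) id \<rho>"
  proof (cases "\<rho> \<in> G")
    case True
    have "\<sigma> \<circ> \<rho> = \<sigma> \<longleftrightarrow> \<rho> = id"
      using inv_comp_cancel[OF \<sigma>, of \<rho>] \<sigma> by (metis comp_id inv_comp)
    then show ?thesis
      using cp_mult_single_left[OF inv_in_G[OF \<sigma>] True] \<sigma>
      by (auto simp: single_def field_aut_zero[OF aut_G[OF inv_in_G[OF \<sigma>]]])
  next
    case False
    then show ?thesis using id_in_G by (auto simp: cp_mult_outside single_def)
  qed
qed

lemma single_in_order: "s \<in> S \<Longrightarrow> \<sigma> \<in> G \<Longrightarrow> single s \<sigma> \<in> cp_order G S"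
  using subring_zero[OF S_subring] by (auto simp: cp_order_def cp_carrier_def single_def)

text \<open>For an ideal \<open>I\<close> this is the largest graded left ideal with degree-one
  component \<open>I\<close>: the condition says that multiplying each homogeneous component on the
  left by \<open>x_(inv \<sigma>)\<close> lands in \<open>I\<close>.\<close>

definition graded_ideal :: "'k set \<Rightarrow> (('k \<Rightarrow> 'k) \<Rightarrow> 'k) set" where
  "graded_ideal I = {a \<in> cp_order G S. \<forall>\<sigma>\<in>G. inv \<sigma> (a \<sigma>) * f (inv \<sigma>) \<sigma> \<in> I}"

definition unit_component :: "(('k \<Rightarrow> 'k) \<Rightarrow> 'k) set \<Rightarrow> 'k set" where
  "unit_component L = {s \<in> S. single s id \<in> L}"

lemma orderD: "a \<in> cp_order G S \<Longrightarrow> \<sigma> \<in> G \<Longrightarrow> a \<sigma> \<in> S"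
  by (simp add: cp_order_def)

lemma cp_mult_in_order:
  assumes a: "a \<in> cp_order G S" and b: "b \<in> cp_order G S"
  shows "cp_mult G f a b \<in> cp_order G S"
proof -
  have "cp_mult G f a b \<rho> \<in> S" if \<rho>: "\<rho> \<in> G" for \<rho>
    unfolding cp_mult_def if_P[OF \<rho>]
  proof (rule subring_sum[OF S_subring])
    fix \<sigma> assume \<sigma>: "\<sigma> \<in> G"
    then have "a \<sigma> \<in> S" "\<sigma> (b (inv \<sigma> \<circ> \<rho>)) \<in> S" "f \<sigma> (inv \<sigma> \<circ> \<rho>) \<in> S"
      using \<rho> orderD[OF a] S_aut[OF \<sigma> orderD[OF b]] by auto
    then show "a \<sigma> * \<sigma> (b (inv \<sigma> \<circ> \<rho>)) * f \<sigma> (inv \<sigma> \<circ> \<rho>) \<in> S"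
      by (intro subring_mult[OF S_subring])
  qed
  then show ?thesis by (simp add: cp_order_def cp_carrier_def cp_mult_outside)
qed

text \<open>Pull the term \<open>(r_\<sigma> x_\<sigma>)(a_\<tau> x_\<tau>)\<close> of degree
  \<open>\<rho>\<close> back to degree one by \<open>x_(inv \<rho>)\<close>. The cocycle identity
  for \<open>inv \<rho>\<close>, \<open>\<sigma>\<close>, \<open>\<tau>\<close> turns the result
  into an element of \<open>S\<close> times the pullback of
  \<open>a_\<tau> x_\<tau>\<close>.\<close>

lemma cp_mult_in_graded_ideal:
  assumes I: "ideal_in S I" and r: "r \<in> cp_order G S" and a: "a \<in> graded_ideal I"
  shows "cp_mult G f r a \<in> graded_ideal I"
proof -
  have ao: "a \<in> cp_order G S" using a by (simp add: graded_ideal_def)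
  have "inv \<rho> (cp_mult G f r a \<rho>) * f (inv \<rho>) \<rho> \<in> I" if \<rho>: "\<rho> \<in> G" for \<rho>
  proof -
    note i\<rho> = aut_G[OF inv_in_G[OF \<rho>]]
    have "inv \<rho> (cp_mult G f r a \<rho>) * f (inv \<rho>) \<rho>
      = (\<Sum>\<sigma>\<in>G. inv \<rho> (r \<sigma> * \<sigma> (a (inv \<sigma> \<circ> \<rho>)) * f \<sigma> (inv \<sigma> \<circ> \<rho>)) * f (inv \<rho>) \<rho>)"
      unfolding cp_mult_def if_P[OF \<rho>] field_aut_sum[OF i\<rho>] sum_distrib_right ..
    also have "\<dots> \<in> I"
    proof (rule ideal_sum[OF I])
      fix \<sigma> assume \<sigma>: "\<sigma> \<in> G"
      define \<tau> where "\<tau> = inv \<sigma> \<circ> \<rho>"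
      have \<tau>: "\<tau> \<in> G" using \<sigma> \<rho> by (simp add: \<tau>_def)
      have \<rho>\<sigma>: "\<rho> = \<sigma> \<circ> \<tau>" using \<sigma> by (simp add: \<tau>_def)
      have it: "inv \<rho> \<circ> \<sigma> = inv \<tau>" using \<sigma> \<rho> by (simp add: \<tau>_def inv_comp_distrib)
      have "inv \<rho> (r \<sigma> * \<sigma> (a \<tau>) * f \<sigma> \<tau>) * f (inv \<rho>) \<rho>
        = inv \<rho> (r \<sigma>) * (inv \<rho> \<circ> \<sigma>) (a \<tau>) * (inv \<rho> (f \<sigma> \<tau>) * f (inv \<rho>) (\<sigma> \<circ> \<tau>))"
        by (simp add: field_aut_mult[OF i\<rho>] mult.assoc flip: \<rho>\<sigma>)
      also have "\<dots> = (inv \<rho> (r \<sigma>) * f (inv \<rho>) \<sigma>) * (inv \<tau> (a \<tau>) * f (inv \<tau>) \<tau>)"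
        unfolding f_cocycle[OF inv_in_G[OF \<rho>] \<sigma> \<tau>] it by (simp add: mult_ac)
      also have "\<dots> \<in> I"
      proof (rule ideal_mult[OF I])
        show "inv \<rho> (r \<sigma>) * f (inv \<rho>) \<sigma> \<in> S"
          using \<rho> \<sigma> S_aut[OF inv_in_G[OF \<rho>] orderD[OF r \<sigma>]] subring_mult[OF S_subring] by simp
        show "inv \<tau> (a \<tau>) * f (inv \<tau>) \<tau> \<in> I" using a \<tau> by (simp add: graded_ideal_def)
      qed
      finally show "inv \<rho> (r \<sigma> * \<sigma> (a (inv \<sigma> \<circ> \<rho>)) * f \<sigma> (inv \<sigma> \<circ> \<rho>)) * f (inv \<rho>) \<rho> \<in> I"
        by (simp add: \<tau>_def)
    qed
    finally show ?thesis .
  qed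
  then show ?thesis using cp_mult_in_order[OF r ao] by (simp add: graded_ideal_def)
qed

lemma graded_left_ideal_graded_ideal:
  assumes I: "ideal_in S I"
  shows "graded_left_ideal G S f (graded_ideal I)"
  unfolding graded_left_ideal_def
proof (intro conjI ballI)
  note i0 = field_aut_zero[OF aut_G[OF inv_in_G]]
  show "graded_ideal I \<subseteq> cp_order G S" by (auto simp: graded_ideal_def)
  show "(\<lambda>_. 0) \<in> graded_ideal I"
    using ideal_zero[OF I] subring_zero[OF S_subring]
    by (simp add: graded_ideal_def cp_order_def cp_carrier_def i0)
  show "cp_mult G f r a \<in> graded_ideal I" if "r \<in> cp_order G S" "a \<in> graded_ideal I" for r a
    using cp_mult_in_graded_ideal[OF I that] .
  fix a assume a: "a \<in> graded_ideal I"
  then have ao: "a \<in> cp_order G S" and aI: "\<And>\<sigma>. \<sigma> \<in> G \<Longrightarrow> inv \<sigma> (a \<sigma>) * f (inv \<sigma>) \<sigma> \<in> I"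
    by (auto simp: graded_ideal_def)
  show "cp_neg a \<in> graded_ideal I"
  proof -
    have "cp_neg a \<in> cp_order G S"
      using ao subring_uminus[OF S_subring] by (simp add: cp_order_def cp_carrier_def cp_neg_def)
    moreover have "inv \<sigma> (cp_neg a \<sigma>) * f (inv \<sigma>) \<sigma> \<in> I" if "\<sigma> \<in> G" for \<sigma>
      using ideal_uminus[OF I aI[OF that]] field_aut_uminus[OF aut_G[OF inv_in_G[OF that]]]
      by (simp add: cp_neg_def)
    ultimately show ?thesis by (simp add: graded_ideal_def)
  qed
  show "cp_component a \<sigma> \<in> graded_ideal I" if \<sigma>: "\<sigma> \<in> G" for \<sigma>
  proof -
    have "inv \<tau> (single (a \<sigma>) \<sigma> \<tau>) * f (inv \<tau>) \<tau> \<in> I" if "\<tau> \<in> G" for \<tau>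
      using aI[OF \<sigma>] ideal_zero[OF I] i0[OF that] by (simp add: single_def)
    then show ?thesis
      using single_in_order[OF orderD[OF ao \<sigma>] \<sigma>] by (simp add: graded_ideal_def cp_component_single)
  qed
  show "cp_add a b \<in> graded_ideal I" if b: "b \<in> graded_ideal I" for b
  proof -
    have bo: "b \<in> cp_order G S" and bI: "\<And>\<sigma>. \<sigma> \<in> G \<Longrightarrow> inv \<sigma> (b \<sigma>) * f (inv \<sigma>) \<sigma> \<in> I"
      using b by (auto simp: graded_ideal_def)
    have "cp_add a b \<in> cp_order G S"
      using ao bo subring_add[OF S_subring] by (simp add: cp_order_def cp_carrier_def cp_add_def)
    moreover have "inv \<sigma> (cp_add a b \<sigma>) * f (inv \<sigma>) \<sigma> \<in> I" if "\<sigma> \<in> G" for \<sigma>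
      using ideal_add[OF I aI[OF that] bI[OF that]] field_aut_add[OF aut_G[OF inv_in_G[OF that]]]
      by (simp add: cp_add_def distrib_right)
    ultimately show ?thesis by (simp add: graded_ideal_def)
  qed
qed

lemma graded_left_idealD:
  assumes "graded_left_ideal G S f L"
  shows "L \<subseteq> cp_order G S" "(\<lambda>_. 0) \<in> L" "a \<in> L \<Longrightarrow> b \<in> L \<Longrightarrow> cp_add a b \<in> L"
    "a \<in> L \<Longrightarrow> cp_neg a \<in> L" "r \<in> cp_order G S \<Longrightarrow> a \<in> L \<Longrightarrow> cp_mult G f r a \<in> L"
    "a \<in> L \<Longrightarrow> \<sigma> \<in> G \<Longrightarrow> single (a \<sigma>) \<sigma> \<in> L"
  using assms unfolding graded_left_ideal_def by (simp_all flip: cp_component_single)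

lemma ideal_unit_component:
  assumes L: "graded_left_ideal G S f L"
  shows "ideal_in S (unit_component L)"
  unfolding ideal_in_def
proof (intro conjI ballI)
  note LD = graded_left_idealD[OF L]
  show "unit_component L \<subseteq> S" by (auto simp: unit_component_def)
  have "single 0 id = (\<lambda>_. 0 :: 'k)" by (simp add: single_def)
  then show "0 \<in> unit_component L"
    using LD(2) subring_zero[OF S_subring] by (simp add: unit_component_def)
  fix x assume x: "x \<in> unit_component L"
  have "single (- x) id = cp_neg (single x id)" by (auto simp: single_def cp_neg_def)
  then show "- x \<in> unit_component L"
    using LD(4) x subring_uminus[OF S_subring] by (simp add: unit_component_def)
  show "x + y \<in> unit_component L" if y: "y \<in> unit_component L" for y
  proof -
    have "single (x + y) id = cp_add (single x id) (single y id)" by (auto simp: single_def cp_add_def)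
    then show ?thesis using LD(3) x y subring_add[OF S_subring] by (simp add: unit_component_def)
  qed
  show "r * x \<in> unit_component L" if r: "r \<in> S" for r
    using LD(5)[OF single_in_order[OF r id_in_G], of "single x id"] x r subring_mult[OF S_subring]
    by (simp add: unit_component_def cp_mult_single_id)
qed

lemma graded_left_ideal_subset:
  assumes L: "graded_left_ideal G S f L"
  shows "L \<subseteq> graded_ideal (unit_component L)"
proof
  note LD = graded_left_idealD[OF L]
  fix a assume a: "a \<in> L"
  have ao: "a \<in> cp_order G S" using LD(1) a by blast
  have "inv \<sigma> (a \<sigma>) * f (inv \<sigma>) \<sigma> \<in> unit_component L" if \<sigma>: "\<sigma> \<in> G" for \<sigma>
  proof -
    have "cp_mult G f (single 1 (inv \<sigma>)) (single (a \<sigma>) \<sigma>) \<in> L"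
      by (rule LD(5)[OF single_in_order[OF subring_one[OF S_subring] inv_in_G[OF \<sigma>]] LD(6)[OF a \<sigma>]])
    moreover have "inv \<sigma> (a \<sigma>) * f (inv \<sigma>) \<sigma> \<in> S"
      using \<sigma> S_aut[OF inv_in_G[OF \<sigma>] orderD[OF ao \<sigma>]] subring_mult[OF S_subring] by simp
    ultimately show ?thesis by (simp add: unit_component_def cp_mult_single_inv[OF \<sigma>])
  qed
  then show "a \<in> graded_ideal (unit_component L)" using ao by (simp add: graded_ideal_def)
qed

lemma unit_component_graded_ideal:
  assumes I: "ideal_in S I"
  shows "unit_component (graded_ideal I) = I"
proof (rule set_eqI)
  fix s
  have "single s id \<in> graded_ideal I \<longleftrightarrow> s \<in> I" if s: "s \<in> S"
  proof -
    have "inv \<sigma> (single s id \<sigma>) * f (inv \<sigma>) \<sigma> = (if \<sigma> = id then s else 0)" if "\<sigma> \<in> G" for \<sigma>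
      using that field_aut_zero[OF aut_G[OF inv_in_G[OF that]]] by (simp add: single_def inv_id)
    then show ?thesis
      using single_in_order[OF s id_in_G] ideal_zero[OF I] by (auto simp: graded_ideal_def)
  qed
  then show "s \<in> unit_component (graded_ideal I) \<longleftrightarrow> s \<in> I"
    using ideal_subset[OF I, of s] by (auto simp: unit_component_def)
qed

lemma graded_left_ideal_eq_order:
  assumes L: "graded_left_ideal G S f L" and 1: "1 \<in> unit_component L"
  shows "L = cp_order G S"
proof
  show "L \<subseteq> cp_order G S" by (rule graded_left_idealD(1)[OF L])
  show "cp_order G S \<subseteq> L"
  proof
    fix a assume a: "a \<in> cp_order G S"
    have "cp_mult G f a (single 1 id) \<in> L"
      using 1 by (intro graded_left_idealD(5)[OF L a]) (simp add: unit_component_def)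
    then show "a \<in> L" by (simp add: cp_mult_one[OF a])
  qed
qed

lemma graded_ideal_mono: "I \<subseteq> J \<Longrightarrow> graded_ideal I \<subseteq> graded_ideal J"
  by (auto simp: graded_ideal_def)

lemma graded_ideal_proper:
  assumes I: "ideal_in S I" and proper: "I \<noteq> S"
  shows "graded_ideal I \<noteq> cp_order G S"
proof
  assume "graded_ideal I = cp_order G S"
  then have "1 \<in> unit_component (graded_ideal I)"
    using single_in_order[OF _ id_in_G, of 1] subring_one[OF S_subring] by (simp add: unit_component_def)
  then show False using ideal_eq_ring[OF I] proper by (simp add: unit_component_graded_ideal[OF I])
qed

text \<open>Proper graded left ideals have proper degree-one components, and
  \<open>graded_ideal\<close> sends proper ideals to proper graded left ideals. Both passages
  preserve inclusions, so maximality transfers in both directions.\<close>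

lemma maximal_graded_left_ideal_iff:
  "maximal_graded_left_ideal G S f L \<longleftrightarrow> (\<exists>M. maximal_ideal_in S M \<and> L = graded_ideal M)"
proof
  assume max: "maximal_graded_left_ideal G S f L"
  then have L: "graded_left_ideal G S f L" "L \<noteq> cp_order G S"
    and Lmax: "\<And>J. graded_left_ideal G S f J \<Longrightarrow> L \<subseteq> J \<Longrightarrow> J = L \<or> J = cp_order G S"
    by (auto simp: maximal_graded_left_ideal_def)
  define M where "M = unit_component L"
  have M: "ideal_in S M" unfolding M_def by (rule ideal_unit_component[OF L(1)])
  have MS: "M \<noteq> S"
    using graded_left_ideal_eq_order[OF L(1)] L(2) subring_one[OF S_subring] by (auto simp: M_def)
  have sub: "L \<subseteq> graded_ideal M" unfolding M_def by (rule graded_left_ideal_subset[OF L(1)])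
  \<comment> \<open>For proper \<open>J\<close> the graded left ideal \<open>graded_ideal J\<close>
    is proper and contains \<open>L\<close>, so maximality of \<open>L\<close> identifies the
    two.\<close>
  have eq: "L = graded_ideal J" if J: "ideal_in S J" "M \<subseteq> J" "J \<noteq> S" for J
    using Lmax[OF graded_left_ideal_graded_ideal[OF J(1)]] graded_ideal_proper[OF J(1,3)]
      sub graded_ideal_mono[OF J(2)] by blast
  have "J = M \<or> J = S" if J: "ideal_in S J" "M \<subseteq> J" for J
  proof (cases "J = S")
    case False
    then have "unit_component L = J" using eq[OF J] unit_component_graded_ideal[OF J(1)] by simp
    then show ?thesis by (simp add: M_def)
  qed simp
  then have "maximal_ideal_in S M" using M MS by (auto simp: maximal_ideal_in_def)
  moreover have "L = graded_ideal M" using eq[OF M _ MS] by simp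
  ultimately show "\<exists>M. maximal_ideal_in S M \<and> L = graded_ideal M" by blast
next
  assume "\<exists>M. maximal_ideal_in S M \<and> L = graded_ideal M"
  then obtain M where M: "maximal_ideal_in S M" and L: "L = graded_ideal M" by blast
  note I = maximal_ideal[OF M]
  have "J = L \<or> J = cp_order G S" if J: "graded_left_ideal G S f J" "L \<subseteq> J" for J
  proof -
    have "unit_component L \<subseteq> unit_component J" using J(2) by (auto simp: unit_component_def)
    then have "M \<subseteq> unit_component J" unfolding L unit_component_graded_ideal[OF I] .
    then have "unit_component J = M \<or> unit_component J = S"
      using M ideal_unit_component[OF J(1)] by (auto simp: maximal_ideal_in_def)
    then show ?thesis
    proof
      assume "unit_component J = M"
      then show ?thesis using graded_left_ideal_subset[OF J(1)] J(2) L by auto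
    next
      assume "unit_component J = S"
      then show ?thesis
        using graded_left_ideal_eq_order[OF J(1)] subring_one[OF S_subring] by simp
    qed
  qed
  then show "maximal_graded_left_ideal G S f L"
    using graded_left_ideal_graded_ideal[OF I] graded_ideal_proper[OF I] M L
    by (auto simp: maximal_graded_left_ideal_def maximal_ideal_in_def)
qed

lemma graded_jacobson_eq: "graded_jacobson G S f = graded_ideal (jacobson_radical S)"
proof (rule set_eqI)
  fix a
  have "a \<in> graded_jacobson G S f \<longleftrightarrow>
      a \<in> cp_order G S \<and> (\<forall>M. maximal_ideal_in S M \<longrightarrow> a \<in> graded_ideal M)"
    unfolding graded_jacobson_def maximal_graded_left_ideal_iff by blast
  also have "\<dots> \<longleftrightarrow> a \<in> graded_ideal (jacobson_radical S)"
  proof (cases "a \<in> cp_order G S")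
    case True
    have "inv \<sigma> (a \<sigma>) * f (inv \<sigma>) \<sigma> \<in> S" if \<sigma>: "\<sigma> \<in> G" for \<sigma>
      using \<sigma> S_aut[OF inv_in_G[OF \<sigma>] orderD[OF True \<sigma>]] subring_mult[OF S_subring] by simp
    then show ?thesis using True by (auto simp: graded_ideal_def jacobson_radical_def)
  qed (simp add: graded_ideal_def)
  finally show "a \<in> graded_jacobson G S f \<longleftrightarrow> a \<in> graded_ideal (jacobson_radical S)" .
qed

text \<open>The Jacobson radical of \<open>S\<close> is stable under \<open>G\<close>, so
  \<open>\<sigma>\<close> may be applied to the defining condition; it carries
  \<open>f (inv \<sigma>) \<sigma>\<close> to \<open>f \<sigma> (inv \<sigma>)\<close>.\<close>

lemma graded_jacobson_iff:
  "a \<in> graded_jacobson G S f \<longleftrightarrow>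
    a \<in> cp_order G S \<and> (\<forall>\<sigma>\<in>G. a \<sigma> * f \<sigma> (inv \<sigma>) \<in> jacobson_radical S)"
proof -
  have "inv \<sigma> (a \<sigma>) * f (inv \<sigma>) \<sigma> \<in> jacobson_radical S \<longleftrightarrow> a \<sigma> * f \<sigma> (inv \<sigma>) \<in> jacobson_radical S"
    if \<sigma>: "\<sigma> \<in> G" for \<sigma>
  proof -
    have "\<sigma> (inv \<sigma> (a \<sigma>) * f (inv \<sigma>) \<sigma>) = a \<sigma> * f \<sigma> (inv \<sigma>)"
      using \<sigma> by (simp add: field_aut_mult[OF aut_G[OF \<sigma>]] f_inv_swap)
    then show ?thesis
      using aut_jacobson_radical[OF \<sigma>, of "inv \<sigma> (a \<sigma>) * f (inv \<sigma>) \<sigma>"]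
        aut_jacobson_radical[OF inv_in_G[OF \<sigma>], of "a \<sigma> * f \<sigma> (inv \<sigma>)"] \<sigma>
      by (metis inv_apply)
  qed
  then show ?thesis by (auto simp: graded_jacobson_eq graded_ideal_def)
qed

section \<open>Elements of the left order and values of the cocycle\<close>

lemma order_subset_left_order: "cp_order G S \<subseteq> left_order G f (graded_jacobson G S f)"
  using cp_mult_in_graded_ideal[OF ideal_jacobson_radical[OF S_subring]]
  by (auto simp: left_order_def graded_jacobson_eq cp_order_def)

text \<open>Multiply \<open>x\<close> by the radical element \<open>y\<close> of degree
  \<open>inv \<sigma>\<close> and read off the degree-one coefficient: only
  \<open>x \<sigma>\<close> contributes to it.\<close>

lemma left_order_coefficient:
  assumes x: "x \<in> left_order G f (graded_jacobson G S f)" and \<sigma>: "\<sigma> \<in> G"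
    and s: "s \<in> S" "s * f \<sigma> (inv \<sigma>) \<in> jacobson_radical S"
  shows "x \<sigma> * (s * f \<sigma> (inv \<sigma>)) \<in> jacobson_radical S"
proof -
  define y where "y = single (inv \<sigma> s) (inv \<sigma>)"
  have "inv \<sigma> s * f (inv \<sigma>) \<sigma> = inv \<sigma> (s * f \<sigma> (inv \<sigma>))"
    using f_inv_swap[of "inv \<sigma>"] \<sigma> by (simp add: field_aut_mult[OF aut_G[OF inv_in_G[OF \<sigma>]]])
  then have e: "inv \<sigma> s * f (inv \<sigma>) \<sigma> \<in> jacobson_radical S"
    using aut_jacobson_radical[OF inv_in_G[OF \<sigma>] s(2)] by simp
  have "y \<in> graded_jacobson G S f"
    unfolding graded_jacobson_iff y_def
    using single_in_order[OF S_aut[OF inv_in_G[OF \<sigma>] s(1)] inv_in_G[OF \<sigma>]] e \<sigma>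
      ideal_zero[OF ideal_jacobson_radical[OF S_subring]]
    by (auto simp: single_def)
  then have "cp_mult G f x y \<in> graded_jacobson G S f" using x by (simp add: left_order_def)
  then have "cp_mult G f x y id * f id (inv id) \<in> jacobson_radical S"
    using id_in_G unfolding graded_jacobson_iff by blast
  moreover have "cp_mult G f x y id = x \<sigma> * s * f \<sigma> (inv \<sigma>)"
    unfolding y_def using cp_mult_single_right[OF inv_in_G[OF \<sigma>] id_in_G] \<sigma> by simp
  ultimately show ?thesis by (simp add: inv_id mult.assoc)
qed

lemma f_inv_notin_sq_imp:
  assumes cond: "\<And>\<sigma> M. \<sigma> \<in> G \<Longrightarrow> maximal_ideal_in S M \<Longrightarrow> f \<sigma> (inv \<sigma>) \<notin> ideal_sq M"
    and \<sigma>: "\<sigma> \<in> G" and \<tau>: "\<tau> \<in> G" and M: "maximal_ideal_in S M"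
  shows "f \<sigma> \<tau> \<notin> ideal_sq M"
proof
  assume "f \<sigma> \<tau> \<in> ideal_sq M"
  then have "f (\<sigma> \<circ> \<tau>) (inv \<tau>) * f \<sigma> \<tau> \<in> ideal_sq M"
    using \<sigma> \<tau> by (intro ideal_sq_mult[OF maximal_ideal[OF M]]) auto
  then have "\<sigma> (f \<tau> (inv \<tau>)) \<in> ideal_sq M"
    using f_inv_factor[OF \<sigma> \<tau>] by (simp add: mult.commute)
  then have "inv \<sigma> (\<sigma> (f \<tau> (inv \<tau>))) \<in> ideal_sq (inv \<sigma> ` M)"
    by (rule ideal_sq_image[OF aut_G[OF inv_in_G[OF \<sigma>]]])
  then show False using cond[OF \<tau> maximal_ideal_image[OF inv_in_G[OF \<sigma>] M]] \<sigma> by simp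
qed

text \<open>Among the \<open>\<sigma>\<close> with \<open>f \<sigma> (inv \<sigma>) \<in> M\<^sup>2\<close> choose one for which the fewest \<open>\<tau>\<close> satisfy
  \<open>f \<sigma> \<tau> \<notin> M\<close>. Passing from \<open>\<sigma>\<close> to \<open>\<sigma> \<circ> \<tau>\<close> for such a \<open>\<tau>\<close> can only shrink this set, so
  minimality forces \<open>f (\<sigma> \<circ> \<tau>) (inv \<tau>) \<notin> M\<close>.\<close>

lemma extremal_bad_element:
  assumes M: "maximal_ideal_in S M" and bad: "\<sigma>\<^sub>0 \<in> G" "f \<sigma>\<^sub>0 (inv \<sigma>\<^sub>0) \<in> ideal_sq M"
  obtains \<sigma> where "\<sigma> \<in> G" "f \<sigma> (inv \<sigma>) \<in> ideal_sq M"
    "\<And>\<tau>. \<tau> \<in> G \<Longrightarrow> f \<sigma> \<tau> \<notin> M \<Longrightarrow> \<sigma> (f \<tau> (inv \<tau>)) \<notin> M"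
proof -
  note I = maximal_ideal[OF M]
  define B where "B = (\<lambda>\<sigma>. \<sigma> \<in> G \<and> f \<sigma> (inv \<sigma>) \<in> ideal_sq M)"
  define U where "U = (\<lambda>\<sigma>. {\<tau> \<in> G. f \<sigma> \<tau> \<notin> M})"
  obtain \<sigma> where \<sigma>B: "B \<sigma>" and min: "\<And>\<tau>. B \<tau> \<Longrightarrow> card (U \<sigma>) \<le> card (U \<tau>)"
    using ex_has_least_nat[of B \<sigma>\<^sub>0 "\<lambda>\<sigma>. card (U \<sigma>)"] bad by (auto simp: B_def)
  have \<sigma>: "\<sigma> \<in> G" "f \<sigma> (inv \<sigma>) \<in> ideal_sq M" using \<sigma>B by (auto simp: B_def)
  have finU: "finite (U \<rho>)" for \<rho> using finite_G by (simp add: U_def)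
  have "\<sigma> (f \<tau> (inv \<tau>)) \<notin> M" if \<tau>: "\<tau> \<in> G" "f \<sigma> \<tau> \<notin> M" for \<tau>
  proof -
    have \<sigma>\<tau>: "\<sigma> \<circ> \<tau> \<in> G" using \<sigma> \<tau> by simp
    \<comment> \<open>By \<open>f_comp_inv\<close> this product is a multiple of
      \<open>f \<sigma> (inv \<sigma>)\<close>. Cancelling \<open>f \<sigma> \<tau>\<close>, which
      is outside \<open>M\<close>, shows that \<open>\<sigma> \<circ> \<tau>\<close> is again a
      candidate.\<close>
    have "f \<sigma> \<tau> * f (\<sigma> \<circ> \<tau>) (inv (\<sigma> \<circ> \<tau>)) \<in> ideal_sq M"
      unfolding f_comp_inv[OF \<sigma>(1) \<tau>(1), symmetric]
      using \<sigma> \<tau> \<sigma>\<tau> S_aut[OF \<sigma>(1)] by (intro ideal_sq_mult[OF I]) auto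
    then have "B (\<sigma> \<circ> \<tau>)"
      unfolding B_def using maximal_ideal_sq_cancel[OF S_subring M, of "f \<sigma> \<tau>"] \<sigma> \<tau> \<sigma>\<tau> by auto
    have sub: "(\<lambda>\<gamma>. \<tau> \<circ> \<gamma>) ` U (\<sigma> \<circ> \<tau>) \<subseteq> U \<sigma>"
    proof
      fix \<rho> assume "\<rho> \<in> (\<lambda>\<gamma>. \<tau> \<circ> \<gamma>) ` U (\<sigma> \<circ> \<tau>)"
      then obtain \<gamma> where \<gamma>: "\<rho> = \<tau> \<circ> \<gamma>" "\<gamma> \<in> G" "f (\<sigma> \<circ> \<tau>) \<gamma> \<notin> M" by (auto simp: U_def)
      have "f \<sigma> \<tau> * f (\<sigma> \<circ> \<tau>) \<gamma> \<in> S - M"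
        using \<sigma> \<tau> \<gamma> \<sigma>\<tau> by (intro maximal_ideal_diff_mult[OF S_subring M]) auto
      then have "\<sigma> (f \<tau> \<gamma>) * f \<sigma> (\<tau> \<circ> \<gamma>) \<notin> M"
        using f_cocycle[OF \<sigma>(1) \<tau>(1) \<gamma>(2)] by simp
      then have "f \<sigma> (\<tau> \<circ> \<gamma>) \<notin> M"
        using ideal_mult[OF I S_aut[OF \<sigma>(1) f_in_S[OF \<tau>(1) \<gamma>(2)]]] by blast
      then show "\<rho> \<in> U \<sigma>" using \<gamma> \<tau> by (simp add: U_def)
    qed
    have inj: "inj_on (\<lambda>\<gamma>. \<tau> \<circ> \<gamma>) (U (\<sigma> \<circ> \<tau>))"
      by (rule inj_on_inverseI[of _ "\<lambda>\<gamma>. inv \<tau> \<circ> \<gamma>"]) (simp add: \<tau>)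
    \<comment> \<open>Left translation by \<open>\<tau>\<close> is injective, so minimality turns
      the inclusion \<open>sub\<close> into an equality. As \<open>id\<close> is in
      \<open>U \<sigma>\<close>, its preimage \<open>inv \<tau>\<close> must be in
      \<open>U (\<sigma> \<circ> \<tau>)\<close>.\<close>
    have "card (U \<sigma>) \<le> card ((\<lambda>\<gamma>. \<tau> \<circ> \<gamma>) ` U (\<sigma> \<circ> \<tau>))"
      unfolding card_image[OF inj] by (rule min) fact
    then have "(\<lambda>\<gamma>. \<tau> \<circ> \<gamma>) ` U (\<sigma> \<circ> \<tau>) = U \<sigma>"
      by (rule card_seteq[OF finU sub])
    moreover have "id \<in> U \<sigma>" using \<sigma> one_notin_maximal[OF M] by (simp add: U_def)
    ultimately obtain \<gamma> where \<gamma>: "id = \<tau> \<circ> \<gamma>" "\<gamma> \<in> U (\<sigma> \<circ> \<tau>)" by auto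
    have "\<gamma> = inv \<tau>" using inv_comp_cancel[OF \<tau>(1), of \<gamma>] \<gamma>(1) by (metis comp_id)
    then have "f (\<sigma> \<circ> \<tau>) (inv \<tau>) \<notin> M" using \<gamma>(2) by (simp add: U_def)
    then have "f \<sigma> \<tau> * f (\<sigma> \<circ> \<tau>) (inv \<tau>) \<in> S - M"
      using \<sigma> \<tau> \<sigma>\<tau> by (intro maximal_ideal_diff_mult[OF S_subring M]) auto
    then show ?thesis using f_inv_factor[OF \<sigma>(1) \<tau>(1)] by simp
  qed
  then show thesis using that \<sigma> by blast
qed

end

subsection \<open>The left order of the graded Jacobson radical\<close>

context crossed_product_order
begin

text \<open>For an extremal \<open>\<sigma>\<close> the witness is \<open>k x_\<sigma>\<close>.
  Membership in the left order demands two things of each product with a radical element: that its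
  coefficients be in \<open>S\<close>, which uses extremality, and that they satisfy the radical
  condition, which uses that \<open>f \<sigma> (inv \<sigma>)\<close> is in the square of
  \<open>M\<close>.\<close>

lemma left_order_neq_order:
  assumes M: "maximal_ideal_in S M" and bad: "\<sigma>\<^sub>0 \<in> G" "f \<sigma>\<^sub>0 (inv \<sigma>\<^sub>0) \<in> ideal_sq M"
    and k: "k \<notin> S" "\<And>y. y \<in> M \<Longrightarrow> k * y \<in> S"
  shows "left_order G f (graded_jacobson G S f) \<noteq> cp_order G S"
proof -
  note I = maximal_ideal[OF M]
  obtain \<sigma> where \<sigma>: "\<sigma> \<in> G" "f \<sigma> (inv \<sigma>) \<in> ideal_sq M"
    and ext: "\<And>\<tau>. \<tau> \<in> G \<Longrightarrow> f \<sigma> \<tau> \<notin> M \<Longrightarrow> \<sigma> (f \<tau> (inv \<tau>)) \<notin> M"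
    using extremal_bad_element[OF M bad] by blast
  have k_sq: "k * y \<in> M" if "y \<in> ideal_sq M" for y
  proof -
    from that obtain n :: nat and a b
      where ab: "\<forall>i<n. a i \<in> M \<and> b i \<in> M" "y = (\<Sum>i<n. a i * b i)"
      unfolding ideal_sq_def by blast
    have "k * y = (\<Sum>i<n. (k * a i) * b i)" unfolding ab(2) by (simp add: sum_distrib_left mult.assoc)
    also have "\<dots> \<in> M"
    proof (rule ideal_sum[OF I])
      fix i assume "i \<in> {..<n}"
      then show "(k * a i) * b i \<in> M" using ab(1) k(2) ideal_mult[OF I] by blast
    qed
    finally show ?thesis .
  qed
  have k_J: "k * y \<in> jacobson_radical S" if y: "y \<in> jacobson_radical S" "y \<in> ideal_sq M" for y
  proof (rule jacobson_radicalI)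
    show kyS: "k * y \<in> S" by (rule ideal_subset[OF I k_sq[OF y(2)]])
    fix N assume N: "maximal_ideal_in S N"
    show "k * y \<in> N"
    proof (cases "M \<subseteq> N")
      case True
      then show ?thesis using k_sq[OF y(2)] by blast
    next
      case False
      \<comment> \<open>At a maximal ideal not containing \<open>M\<close>, multiply by
        \<open>m\<close>: \<open>k * m\<close> is in \<open>S\<close> and \<open>y\<close> is in
        \<open>N\<close>, so primality of \<open>N\<close> gives
        \<open>k * y \<in> N\<close>.\<close>
      then obtain m where m: "m \<in> M" "m \<notin> N" by blast
      have "(k * m) * y \<in> N"
        by (rule ideal_mult[OF maximal_ideal[OF N] k(2)[OF m(1)] jacobson_radicalD(2)[OF y(1) N]])
      then have "m * (k * y) \<in> N" by (simp add: mult_ac)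
      then show ?thesis
        using maximal_ideal_prime[OF S_subring N ideal_subset[OF I m(1)] kyS] m(2) by blast
    qed
  qed
  have "cp_mult G f (single k \<sigma>) a \<in> graded_jacobson G S f" if a: "a \<in> graded_jacobson G S f" for a
  proof -
    have ao: "a \<in> cp_order G S" and aJ: "\<And>\<tau>. \<tau> \<in> G \<Longrightarrow> a \<tau> * f \<tau> (inv \<tau>) \<in> jacobson_radical S"
      using a by (auto simp: graded_jacobson_iff)
    have main: "k * \<sigma> (a \<tau>) * f \<sigma> \<tau> \<in> S
        \<and> k * \<sigma> (a \<tau>) * f \<sigma> \<tau> * f (\<sigma> \<circ> \<tau>) (inv (\<sigma> \<circ> \<tau>)) \<in> jacobson_radical S"
      if \<tau>: "\<tau> \<in> G" for \<tau>
    proof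
      have \<sigma>\<tau>: "\<sigma> \<circ> \<tau> \<in> G" using \<sigma> \<tau> by simp
      have saS: "\<sigma> (a \<tau>) \<in> S" by (rule S_aut[OF \<sigma>(1) orderD[OF ao \<tau>]])
      have sJ: "\<sigma> (a \<tau>) * \<sigma> (f \<tau> (inv \<tau>)) \<in> jacobson_radical S"
        using aut_jacobson_radical[OF \<sigma>(1) aJ[OF \<tau>]] by (simp add: field_aut_mult[OF aut_G[OF \<sigma>(1)]])
      \<comment> \<open>Either the cocycle value is in \<open>M\<close>, or extremality puts
        \<open>\<sigma> (f \<tau> (inv \<tau>))\<close> outside \<open>M\<close>; in the latter case
        primality applied to \<open>sJ\<close> forces \<open>\<sigma> (a \<tau>)\<close> into
        \<open>M\<close>.\<close>
      have "\<sigma> (a \<tau>) * f \<sigma> \<tau> \<in> M"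
      proof (cases "f \<sigma> \<tau> \<in> M")
        case True
        then show ?thesis by (rule ideal_mult[OF I saS])
      next
        case False
        have "\<sigma> (a \<tau>) \<in> M"
          using maximal_ideal_prime[OF S_subring M saS S_aut[OF \<sigma>(1) f_in_S[OF \<tau> inv_in_G[OF \<tau>]]]
              jacobson_radicalD(2)[OF sJ M]] ext[OF \<tau> False] by blast
        then show ?thesis by (rule ideal_mult_right[OF I f_in_S[OF \<sigma>(1) \<tau>]])
      qed
      then show "k * \<sigma> (a \<tau>) * f \<sigma> \<tau> \<in> S" using k(2) by (simp add: mult.assoc)
      define y where "y = \<sigma> (a \<tau>) * f \<sigma> \<tau> * f (\<sigma> \<circ> \<tau>) (inv (\<sigma> \<circ> \<tau>))"
      have "y = (\<sigma> (a \<tau>) * \<sigma> (f \<tau> (inv (\<sigma> \<circ> \<tau>)))) * f \<sigma> (inv \<sigma>)"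
        unfolding y_def mult.assoc f_comp_inv[OF \<sigma>(1) \<tau>] ..
      moreover have "\<sigma> (a \<tau>) * \<sigma> (f \<tau> (inv (\<sigma> \<circ> \<tau>))) \<in> S"
        by (rule subring_mult[OF S_subring saS S_aut[OF \<sigma>(1) f_in_S[OF \<tau> inv_in_G[OF \<sigma>\<tau>]]]])
      ultimately have ysq: "y \<in> ideal_sq M" using ideal_sq_mult[OF I _ \<sigma>(2)] by simp
      \<comment> \<open>Up to the cocycle factor, \<open>y\<close> is the coefficient of
        \<open>x_\<sigma> a\<close>, and the graded radical is closed under left multiplication by
        \<open>x_\<sigma>\<close>.\<close>
      have yJ: "y \<in> jacobson_radical S"
      proof -
        have "cp_mult G f (single 1 \<sigma>) a \<in> graded_jacobson G S f"
          using order_subset_left_order single_in_order[OF subring_one[OF S_subring] \<sigma>(1)] a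
          by (auto simp: left_order_def)
        then have "cp_mult G f (single 1 \<sigma>) a (\<sigma> \<circ> \<tau>) * f (\<sigma> \<circ> \<tau>) (inv (\<sigma> \<circ> \<tau>)) \<in> jacobson_radical S"
          using \<sigma>\<tau> unfolding graded_jacobson_iff by blast
        then show ?thesis
          unfolding cp_mult_single_left[OF \<sigma>(1) \<sigma>\<tau>] inv_comp_cancel[OF \<sigma>(1)] by (simp add: y_def)
      qed
      show "k * \<sigma> (a \<tau>) * f \<sigma> \<tau> * f (\<sigma> \<circ> \<tau>) (inv (\<sigma> \<circ> \<tau>)) \<in> jacobson_radical S"
        using k_J[OF yJ ysq] by (simp add: y_def mult.assoc)
    qed
    have "cp_mult G f (single k \<sigma>) a \<rho> \<in> S \<and>
        cp_mult G f (single k \<sigma>) a \<rho> * f \<rho> (inv \<rho>) \<in> jacobson_radical S" if \<rho>: "\<rho> \<in> G" for \<rho>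
      using main[of "inv \<sigma> \<circ> \<rho>"] \<sigma>(1) \<rho> unfolding cp_mult_single_left[OF \<sigma>(1) \<rho>] by simp
    then show ?thesis
      unfolding graded_jacobson_iff by (simp add: cp_order_def cp_carrier_def cp_mult_outside)
  qed
  moreover have "single k \<sigma> \<in> cp_carrier G" using \<sigma>(1) by (auto simp: cp_carrier_def single_def)
  ultimately have "single k \<sigma> \<in> left_order G f (graded_jacobson G S f)" by (simp add: left_order_def)
  moreover have "single k \<sigma> \<notin> cp_order G S"
    using k(1) orderD[of "single k \<sigma>" \<sigma>] \<sigma>(1) by (auto simp: single_def)
  ultimately show ?thesis by blast
qed

end

section \<open>The criterion over valuation rings\<close>

locale crossed_product_valuation = galois_valuation G V p
    + crossed_product_order G "integral_closure V" f
  for G :: "('k::field \<Rightarrow> 'k) set" and V p f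
begin

lemma left_order_eq_order_iff:
  assumes p0: "p \<noteq> 0"
  shows "left_order G f (graded_jacobson G S f) = cp_order G S \<longleftrightarrow>
    (\<forall>\<sigma>\<in>G. \<forall>M. maximal_ideal_in S M \<longrightarrow> f \<sigma> (inv \<sigma>) \<notin> ideal_sq M)"
proof (intro iffI ballI allI impI notI)
  fix \<sigma> M
  assume eq: "left_order G f (graded_jacobson G S f) = cp_order G S"
    and \<sigma>: "\<sigma> \<in> G" and M: "maximal_ideal_in S M" and sq: "f \<sigma> (inv \<sigma>) \<in> ideal_sq M"
  note I = maximal_ideal[OF M]
  obtain k m m' where k: "\<And>y. y \<in> M \<Longrightarrow> k * y \<in> S" "m \<in> M" "m' \<in> M" "k * m + m' = 1"
    using maximal_ideal_invertible[OF p0 M] by blast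
  have "k \<notin> S"
  proof
    assume "k \<in> S"
    then have "k * m + m' \<in> M" by (rule ideal_add[OF I ideal_mult[OF I _ k(2)] k(3)])
    then show False using k(4) one_notin_maximal[OF M] by simp
  qed
  then show False using left_order_neq_order[OF M \<sigma> sq _ k(1)] eq by blast
next
  assume cond: "\<forall>\<sigma>\<in>G. \<forall>M. maximal_ideal_in S M \<longrightarrow> f \<sigma> (inv \<sigma>) \<notin> ideal_sq M"
  have "x \<sigma> \<in> S" if x: "x \<in> left_order G f (graded_jacobson G S f)" and \<sigma>: "\<sigma> \<in> G" for x \<sigma>
  proof (rule jacobson_radical_multiplier[OF p0])
    fix a assume a: "a \<in> jacobson_radical S"
    \<comment> \<open>The hypothesis makes every \<open>a\<close> in the Jacobson radical a multiple
      of \<open>f \<sigma> (inv \<sigma>)\<close> in \<open>S\<close>. So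
      \<open>left_order_coefficient\<close> yields \<open>x \<sigma> * a\<close> for all such
      \<open>a\<close>, and \<open>x \<sigma>\<close> multiplies the radical into itself.\<close>
    define s where "s = a * inverse (f \<sigma> (inv \<sigma>))"
    have f0: "f \<sigma> (inv \<sigma>) \<noteq> 0" by (rule f_nonzero[OF \<sigma> inv_in_G[OF \<sigma>]])
    have sS: "s \<in> S"
      unfolding s_def
      by (rule jacobson_radical_multiple[OF p0 f_in_S[OF \<sigma> inv_in_G[OF \<sigma>]] f0 _ a])
        (use cond \<sigma> in blast)
    have sa: "s * f \<sigma> (inv \<sigma>) = a" using f0 by (simp add: s_def mult.assoc)
    show "x \<sigma> * a \<in> jacobson_radical S"
      using left_order_coefficient[OF x \<sigma> sS] a sa by simp
  qed
  then have "left_order G f (graded_jacobson G S f) \<subseteq> cp_order G S"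
    by (auto simp: cp_order_def left_order_def)
  then show "left_order G f (graded_jacobson G S f) = cp_order G S"
    using order_subset_left_order by blast
qed

text \<open>With \<open>p = 0\<close> every nonzero element of \<open>V\<close> is a unit, so
  \<open>V\<close> is the whole fixed field, over which all of \<open>K\<close> is integral.\<close>

lemma S_eq_UNIV:
  assumes p0: "p = 0"
  shows "S = UNIV"
proof -
  have "x \<in> V" if x: "x \<in> fixed_field G" for x
  proof (rule ccontr)
    assume xV: "x \<notin> V"
    then have "inverse x \<in> V" using V_valuation[OF x] by blast
    then have "inverse x = 0" using nonunit_multiple[of "inverse x"] xV p0 by auto
    then show False using xV subring_zero[OF subring_V] by simp
  qed
  then have "coeff (charpoly x) i \<in> V" for x i using charpoly_coeff_fixed by blast
  then have "x \<in> S" for x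
    unfolding integral_closure_def using charpoly_eq_0'[of x] by blast
  then show ?thesis by blast
qed

end

text \<open>The nonunits form the unique maximal ideal. Closure under addition uses that one of
  \<open>x / y\<close> and \<open>y / x\<close> is in \<open>V\<close>, so a sum of nonunits is a
  multiple of one of them. This translates the hypothesis on \<open>J(V)\<close> into the properties
  of its generator \<open>p\<close>.\<close>

lemma (in aut_group) jacobson_radical_valuation_domain:
  assumes val: "valuation_domain_of V (fixed_field G)"
  shows "jacobson_radical V = {x \<in> V. inverse x \<notin> V \<or> x = 0}"
proof -
  have V: "subring_of V" "V \<subseteq> fixed_field G"
    and VV: "\<And>x. x \<in> fixed_field G \<Longrightarrow> x \<in> V \<or> inverse x \<in> V"
    using val by (auto simp: valuation_domain_of_def subring_of_def)
  define N where "N = {x \<in> V. inverse x \<notin> V \<or> x = 0}"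
  have N_mult: "r * x \<in> N" if r: "r \<in> V" and x: "x \<in> N" for r x
  proof -
    have xV: "x \<in> V" using x by (simp add: N_def)
    have "inverse (r * x) \<notin> V" if nz: "r * x \<noteq> 0"
    proof
      assume "inverse (r * x) \<in> V"
      then have "r * inverse (r * x) \<in> V" by (rule subring_mult[OF V(1) r])
      moreover have "r * inverse (r * x) = inverse x" using nz by (simp add: field_simps)
      ultimately have "inverse x \<in> V" by metis
      then show False using x nz by (auto simp: N_def)
    qed
    then show ?thesis using subring_mult[OF V(1) r xV] by (auto simp: N_def)
  qed
  have N_add_aux: "x + y \<in> N" if x: "x \<in> N" and y: "y \<in> N" "y \<noteq> 0" and v: "x * inverse y \<in> V" for x y
  proof -
    have "(x * inverse y + 1) * y \<in> N"
      by (rule N_mult[OF subring_add[OF V(1) v subring_one[OF V(1)]] y(1)])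
    moreover have "(x * inverse y + 1) * y = x + y" using y(2) by (simp add: field_simps)
    ultimately show ?thesis by simp
  qed
  have N_add: "x + y \<in> N" if x: "x \<in> N" and y: "y \<in> N" for x y
  proof (cases "x = 0 \<or> y = 0")
    case True
    then show ?thesis using x y by auto
  next
    case False
    have "x * inverse y \<in> fixed_field G"
      using x y V(2) by (intro subring_mult[OF subring_fixed_field] inverse_fixed_field) (auto simp: N_def)
    then have "x * inverse y \<in> V \<or> y * inverse x \<in> V"
      using VV[of "x * inverse y"] by (simp add: mult.commute)
    then show ?thesis
      using N_add_aux[OF x y] N_add_aux[OF y x] False by (auto simp: add.commute)
  qed
  have N: "ideal_in V N"
    unfolding ideal_in_def
  proof (intro conjI ballI)
    show "N \<subseteq> V" "0 \<in> N" using subring_zero[OF V(1)] by (auto simp: N_def)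
    show "- x \<in> N" if "x \<in> N" for x
      using N_mult[OF subring_uminus[OF V(1) subring_one[OF V(1)]] that] by simp
  qed (fact N_add N_mult)+
  have N1: "1 \<notin> N" using subring_one[OF V(1)] by (simp add: N_def)
  have sub: "J \<subseteq> N \<or> J = V" if J: "ideal_in V J" for J
  proof (cases "J \<subseteq> N")
    case False
    then obtain x where x: "x \<in> J" "x \<notin> N" by blast
    then have "inverse x \<in> V" "x \<noteq> 0" using ideal_subset[OF J x(1)] by (auto simp: N_def)
    then have "1 \<in> J" using ideal_mult[OF J \<open>inverse x \<in> V\<close> x(1)] by simp
    then show ?thesis using ideal_eq_ring[OF J] by blast
  qed simp
  have NV: "N \<noteq> V" using N1 subring_one[OF V(1)] by blast
  have "maximal_ideal_in V M \<longleftrightarrow> M = N" for M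
  proof
    assume M: "maximal_ideal_in V M"
    then have "M \<subseteq> N" using sub[OF maximal_ideal[OF M]] by (auto simp: maximal_ideal_in_def)
    then show "M = N" using M N NV unfolding maximal_ideal_in_def by blast
  next
    assume "M = N"
    then show "maximal_ideal_in V M"
      unfolding maximal_ideal_in_def using N NV sub by blast
  qed
  then show ?thesis by (auto simp: jacobson_radical_def N_def)
qed

theorem theorem2p8:
  fixes G :: "('k::field \<Rightarrow> 'k) set"
    and V S :: "'k set"
    and f :: "('k \<Rightarrow> 'k) \<Rightarrow> ('k \<Rightarrow> 'k) \<Rightarrow> 'k"
  assumes "finite_aut_group G"
    and "valuation_domain_of V (fixed_field G)"
    and "principal_ideal_in V (jacobson_radical V)"
    and "S = integral_closure V"
    and "normalized_cocycle G S f"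
  shows "(left_order G f (graded_jacobson G S f) = cp_order G S \<longleftrightarrow>
           (\<forall>\<sigma>\<in>G. \<forall>M. maximal_ideal_in S M \<longrightarrow> f \<sigma> (inv \<sigma>) \<notin> ideal_sq M))
       \<and> ((\<forall>\<sigma>\<in>G. \<forall>M. maximal_ideal_in S M \<longrightarrow> f \<sigma> (inv \<sigma>) \<notin> ideal_sq M) \<longleftrightarrow>
           (\<forall>\<sigma>\<in>G. \<forall>\<tau>\<in>G. \<forall>M. maximal_ideal_in S M \<longrightarrow> f \<sigma> \<tau> \<notin> ideal_sq M))"
proof -
  interpret aut_group G by unfold_locales (fact assms(1))
  note JV = jacobson_radical_valuation_domain[OF assms(2)]
  have V: "subring_of V" using assms(2) by (simp add: valuation_domain_of_def)
  obtain p where p: "p \<in> V" "jacobson_radical V = {r * p | r. r \<in> V}"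
    using assms(3) unfolding principal_ideal_in_def by blast
  have pJ: "inverse p \<notin> V \<or> p = 0"
  proof -
    have "1 * p \<in> jacobson_radical V" unfolding p(2) using subring_one[OF V] by blast
    then show ?thesis by (simp add: JV)
  qed
  interpret galois_valuation G V p
  proof unfold_locales
    show "p * v \<noteq> 1" if "v \<in> V" for v
      using pJ that inverse_unique[of p v] by auto
    show "\<exists>v\<in>V. x = p * v" if "x \<in> V" "inverse x \<notin> V \<or> x = 0" for x
    proof -
      have "x \<in> {r * p | r. r \<in> V}" using that JV p(2) by auto
      then show ?thesis by (auto simp: mult.commute)
    qed
  qed (fact assms(2) p(1))+
  interpret crossed_product_valuation G V p f
    by unfold_locales (use assms(4,5) in simp)
  have first: "left_order G f (graded_jacobson G S f) = cp_order G S \<longleftrightarrow>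
           (\<forall>\<sigma>\<in>G. \<forall>M. maximal_ideal_in S M \<longrightarrow> f \<sigma> (inv \<sigma>) \<notin> ideal_sq M)"
  proof (cases "p = 0")
    case False
    then show ?thesis unfolding assms(4) by (rule left_order_eq_order_iff)
  next
    \<comment> \<open>If \<open>V\<close> is a field, then \<open>S\<close> is all of
      \<open>K\<close>: the left order and the order both consist of the whole algebra, and no
      maximal ideal contains the nonzero value \<open>f \<sigma> (inv \<sigma>)\<close>. Both sides
      hold.\<close>
    case True
    have SU: "S = UNIV" using S_eq_UNIV[OF True] assms(4) by simp
    have "left_order G f (graded_jacobson G S f) = cp_order G S"
      using order_subset_left_order by (auto simp: SU S_eq_UNIV[OF True] cp_order_def left_order_def)
    moreover have "f \<sigma> (inv \<sigma>) \<notin> ideal_sq M" if \<sigma>: "\<sigma> \<in> G" and M: "maximal_ideal_in S M" for \<sigma> M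
    proof
      assume "f \<sigma> (inv \<sigma>) \<in> ideal_sq M"
      then have fM: "f \<sigma> (inv \<sigma>) \<in> M" using ideal_sq_subset[OF maximal_ideal[OF M]] by blast
      have "inverse (f \<sigma> (inv \<sigma>)) * f \<sigma> (inv \<sigma>) \<in> M"
        by (rule ideal_mult[OF maximal_ideal[OF M] _ fM]) (simp add: SU)
      then show False using f_nonzero[OF \<sigma> inv_in_G[OF \<sigma>]] one_notin_maximal[OF M] by simp
    qed
    ultimately show ?thesis by blast
  qed
  have second: "(\<forall>\<sigma>\<in>G. \<forall>M. maximal_ideal_in S M \<longrightarrow> f \<sigma> (inv \<sigma>) \<notin> ideal_sq M) \<longleftrightarrow>
           (\<forall>\<sigma>\<in>G. \<forall>\<tau>\<in>G. \<forall>M. maximal_ideal_in S M \<longrightarrow> f \<sigma> \<tau> \<notin> ideal_sq M)"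
    using f_inv_notin_sq_imp unfolding assms(4) by (meson inv_in_G)
  show ?thesis using first second by (rule conjI)
qed

end
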